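(* Let $I\subseteq S=\mathbb{K}[x_1,\dots,x_n]$ be a monomial ideal of projective dimension one that is generated in a single degree $d$. Then the following statements are equivalent: (1) $I$ has linear relations; (2) $I$ has a linear resolution; (3) $I$ has linear quotients.
   Context: $S=\mathbb{K}[x_1,\dots,x_n]$ is the polynomial ring over a field $\mathbb{K}$, and $\beta_{i,j}(I)$ denotes the $i$-th graded Betti number of the $S$-module $I$ in degree $j$. The projective dimension of $I$ is that of $I$ as an $S$-module. A monomial ideal $I$ has linear relations (is linearly related) if $\beta_{1,j}(I)=0$ for all $j>d(I)+1$, where $d(I)$ is the maximal degree of a minimal generator of $I$. It has a ($d$-)linear resolution if $\beta_{i,j}(I)=0$ for all $i,j$ with $j-i\ne d$. It has linear quotients if its minimal monomial generators can be ordered as $u_1,\ldots,u_r$ so that $(u_1,\ldots,u_{i-1}):u_i$ is generated by variables for all $i=2,\ldots,r$. *)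

theory Defs
  imports "HOL-Library.Poly_Mapping" "HOL-Library.Extended_Nat"
begin

text \<open>
  The polynomial ring \<open>K[x\<^sub>1, \<dots>, x\<^sub>n]\<close> is modelled by finitely supported functions from exponent
  vectors to coefficients; the variables are indexed by a finite type \<open>'n\<close>, so \<open>n = CARD('n)\<close>.
\<close>

type_synonym 'n expo = "'n \<Rightarrow>\<^sub>0 nat"
type_synonym ('n, 'k) mpoly = "'n expo \<Rightarrow>\<^sub>0 'k"

definition monomial :: "'n expo \<Rightarrow> ('n, 'k::comm_ring_1) mpoly" where
  "monomial u = Poly_Mapping.single u 1"

definition var :: "'n \<Rightarrow> ('n, 'k::comm_ring_1) mpoly" where
  "var i = monomial (Poly_Mapping.single i 1)"

definition expo_deg :: "('n::finite) expo \<Rightarrow> nat" where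
  "expo_deg u = (\<Sum>i\<in>UNIV. Poly_Mapping.lookup u i)"

definition homogeneous :: "nat \<Rightarrow> ('n::finite, 'k::comm_ring_1) mpoly \<Rightarrow> bool" where
  "homogeneous m f \<longleftrightarrow> (\<forall>u\<in>Poly_Mapping.keys f. expo_deg u = m)"

text \<open>A ring is a module over itself; its submodules are its ideals.\<close>

abbreviation ideal_of :: "'a::comm_ring_1 set \<Rightarrow> 'a set" where
  "ideal_of \<equiv> module.span (*)"

definition colon :: "'a::comm_ring_1 set \<Rightarrow> 'a \<Rightarrow> 'a set" where
  "colon J f = {g. g * f \<in> J}"

subsection \<open>Monomial ideals\<close>

definition monomial_ideal :: "('n, 'k::comm_ring_1) mpoly set \<Rightarrow> bool" where
  "monomial_ideal I \<longleftrightarrow> (\<exists>U. I = ideal_of (monomial ` U))"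

definition minimal_monomial_generating_set ::
    "'n expo set \<Rightarrow> ('n, 'k::comm_ring_1) mpoly set \<Rightarrow> bool" where
  "minimal_monomial_generating_set U I \<longleftrightarrow>
     ideal_of (monomial ` U) = I \<and> (\<forall>V. V \<subset> U \<longrightarrow> ideal_of (monomial ` V) \<noteq> I)"

text \<open>A monomial ideal has exactly one minimal monomial generating set.\<close>

definition min_gens :: "('n, 'k::comm_ring_1) mpoly set \<Rightarrow> 'n expo set" where
  "min_gens I = (THE U. minimal_monomial_generating_set U I)"

definition max_gen_deg :: "('n::finite, 'k::comm_ring_1) mpoly set \<Rightarrow> nat" where
  "max_gen_deg I = Max (expo_deg ` min_gens I)"

definition generated_in_degree :: "nat \<Rightarrow> ('n::finite, 'k::comm_ring_1) mpoly set \<Rightarrow> bool" where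
  "generated_in_degree d I \<longleftrightarrow> (\<forall>u\<in>min_gens I. expo_deg u = d)"

definition has_linear_quotients :: "('n, 'k::comm_ring_1) mpoly set \<Rightarrow> bool" where
  "has_linear_quotients I \<longleftrightarrow>
     (\<exists>us. distinct us \<and> set us = min_gens I \<and>
        (\<forall>i. 1 \<le> i \<and> i < length us \<longrightarrow>
           (\<exists>X. colon (ideal_of (monomial ` set (take i us))) (monomial (us ! i))
                = (ideal_of (var ` X) :: ('n, 'k) mpoly set))))"

subsection \<open>Resolutions\<close>

text \<open>
  The modules in a resolution are submodules of the free module \<open>nat \<Rightarrow>\<^sub>0 'a\<close> of countable rank.
\<close>

definition smult :: "'a::comm_ring_1 \<Rightarrow> (nat \<Rightarrow>\<^sub>0 'a) \<Rightarrow> (nat \<Rightarrow>\<^sub>0 'a)" where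
  "smult c x = Poly_Mapping.map (\<lambda>a. c * a) x"

lemma lookup_smult: "Poly_Mapping.lookup (smult c x) k = c * Poly_Mapping.lookup x k"
  by (simp add: smult_def Poly_Mapping.map.rep_eq when_def)

lemma module_smult: "module smult"
  by unfold_locales (auto intro!: poly_mapping_eqI simp: lookup_smult lookup_add algebra_simps)

lemma module_mult: "module ((*) :: 'a::comm_ring_1 \<Rightarrow> 'a \<Rightarrow> 'a)"
  by unfold_locales (auto simp: algebra_simps)

definition basis_vec :: "nat \<Rightarrow> (nat \<Rightarrow>\<^sub>0 'a::comm_ring_1)" where
  "basis_vec k = Poly_Mapping.single k 1"

definition free_module :: "nat \<Rightarrow> (nat \<Rightarrow>\<^sub>0 'a::comm_ring_1) set" where
  "free_module r = {x. Poly_Mapping.keys x \<subseteq> {..<r}}"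

text \<open>
  Projective modules are direct summands of free modules, that is, images of idempotent
  endomorphisms. Countable rank is no restriction for resolving ideals of a Noetherian ring.
\<close>

definition projective :: "(nat \<Rightarrow>\<^sub>0 'a::comm_ring_1) set \<Rightarrow> bool" where
  "projective P \<longleftrightarrow> (\<exists>e. module_hom smult smult e \<and> e \<circ> e = e \<and> P = range e)"

text \<open>
  Exactness of \<open>\<dots> \<rightarrow> P 2 \<rightarrow> P 1 \<rightarrow> P 0 \<rightarrow> I \<rightarrow> 0\<close> with augmentation \<open>\<epsilon> : P 0 \<rightarrow> I\<close> and differentials
  \<open>\<delta> i : P (i + 1) \<rightarrow> P i\<close>. The maps are total on the ambient free module, but only their
  restrictions matter; a linear map on a direct summand always extends.
\<close>

definition is_resolution ::
    "'a::comm_ring_1 set \<Rightarrow> (nat \<Rightarrow> (nat \<Rightarrow>\<^sub>0 'a) set) \<Rightarrow> ((nat \<Rightarrow>\<^sub>0 'a) \<Rightarrow> 'a)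
      \<Rightarrow> (nat \<Rightarrow> (nat \<Rightarrow>\<^sub>0 'a) \<Rightarrow> (nat \<Rightarrow>\<^sub>0 'a)) \<Rightarrow> bool" where
  "is_resolution I P \<epsilon> \<delta> \<longleftrightarrow>
     module_hom smult (*) \<epsilon> \<and> (\<forall>i. module_hom smult smult (\<delta> i)) \<and>
     \<epsilon> ` P 0 = I \<and>
     \<delta> 0 ` P 1 = {x \<in> P 0. \<epsilon> x = 0} \<and>
     (\<forall>i. \<delta> (Suc i) ` P (Suc (Suc i)) = {x \<in> P (Suc i). \<delta> i x = 0})"

definition has_projective_resolution_of_length :: "'a::comm_ring_1 set \<Rightarrow> nat \<Rightarrow> bool" where
  "has_projective_resolution_of_length I p \<longleftrightarrow>
     (\<exists>P \<epsilon> \<delta>. is_resolution I P \<epsilon> \<delta> \<and> (\<forall>i. projective (P i)) \<and> (\<forall>i>p. P i = {0}))"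

definition projective_dimension :: "'a::comm_ring_1 set \<Rightarrow> enat" where
  "projective_dimension I = Inf (enat ` {p. has_projective_resolution_of_length I p})"

subsection \<open>Graded Betti numbers\<close>

text \<open>
  A list \<open>as\<close> of length \<open>r\<close> stands for the graded free module \<open>S(-as!0) \<oplus> \<dots> \<oplus> S(-as!(r-1))\<close>, whose
  \<open>k\<close>-th basis element has degree \<open>as!k\<close>. Shifts in \<open>nat\<close> suffice for resolving ideals of \<open>S\<close>:
  in a minimal graded free resolution no basis element maps to zero, so none has negative degree.
\<close>

definition graded_elem ::
    "nat list \<Rightarrow> nat \<Rightarrow> (nat \<Rightarrow>\<^sub>0 ('n::finite, 'k::comm_ring_1) mpoly) \<Rightarrow> bool" where
  "graded_elem as m x \<longleftrightarrow>
     x \<in> free_module (length as) \<and>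
     (\<forall>k<length as. \<forall>u\<in>Poly_Mapping.keys (Poly_Mapping.lookup x k). expo_deg u + as ! k = m)"

definition minimal_graded_free_resolution ::
    "('n::finite, 'k::field) mpoly set \<Rightarrow> (nat \<Rightarrow> nat list)
      \<Rightarrow> ((nat \<Rightarrow>\<^sub>0 ('n, 'k) mpoly) \<Rightarrow> ('n, 'k) mpoly)
      \<Rightarrow> (nat \<Rightarrow> (nat \<Rightarrow>\<^sub>0 ('n, 'k) mpoly) \<Rightarrow> (nat \<Rightarrow>\<^sub>0 ('n, 'k) mpoly)) \<Rightarrow> bool" where
  "minimal_graded_free_resolution I a \<epsilon> \<delta> \<longleftrightarrow>
     is_resolution I (\<lambda>i. free_module (length (a i))) \<epsilon> \<delta> \<and>
     (\<forall>k<length (a 0). homogeneous (a 0 ! k) (\<epsilon> (basis_vec k))) \<and>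
     (\<forall>i. \<forall>k<length (a (Suc i)). graded_elem (a i) (a (Suc i) ! k) (\<delta> i (basis_vec k))) \<and>
     (\<forall>i. \<forall>x\<in>free_module (length (a (Suc i))). \<forall>k.
        Poly_Mapping.lookup (\<delta> i x) k \<in> ideal_of (range var))"

text \<open>
  \<open>graded_betti I i j\<close> is the multiplicity of \<open>S(-j)\<close> in homological degree \<open>i\<close>. Every homogeneous
  ideal has a minimal graded free resolution, and the multiplicities do not depend on its choice.
\<close>

definition graded_betti :: "('n::finite, 'k::field) mpoly set \<Rightarrow> nat \<Rightarrow> nat \<Rightarrow> nat" where
  "graded_betti I i j =
     count_list ((SOME a. \<exists>\<epsilon> \<delta>. minimal_graded_free_resolution I a \<epsilon> \<delta>) i) j"

definition has_linear_relations :: "('n::finite, 'k::field) mpoly set \<Rightarrow> bool" where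
  "has_linear_relations I \<longleftrightarrow> (\<forall>j. j > max_gen_deg I + 1 \<longrightarrow> graded_betti I 1 j = 0)"

text \<open>The condition \<open>j - i \<noteq> d\<close> is written without truncated subtraction.\<close>

definition has_d_linear_resolution :: "nat \<Rightarrow> ('n::finite, 'k::field) mpoly set \<Rightarrow> bool" where
  "has_d_linear_resolution d I \<longleftrightarrow> (\<forall>i j. j \<noteq> i + d \<longrightarrow> graded_betti I i j = 0)"

definition has_linear_resolution :: "('n::finite, 'k::field) mpoly set \<Rightarrow> bool" where
  "has_linear_resolution I \<longleftrightarrow> (\<exists>d. has_d_linear_resolution d I)"

end

theory Submission
  imports Defs
begin

text \<open>
  Let \<open>u\<^sub>1, \<dots>, u\<^sub>r\<close> be the minimal monomial generators of \<open>I\<close>, all of degree \<open>d\<close>. The kernel of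
  \<open>S\<^sup>r \<rightarrow> I\<close> is generated by the Taylor syzygies
  \<open>\<tau>\<^sub>p\<^sub>q = (lcm(u\<^sub>p, u\<^sub>q) / u\<^sub>p) e\<^sub>p - (lcm(u\<^sub>p, u\<^sub>q) / u\<^sub>q) e\<^sub>q\<close>, so some irredundant set \<open>B\<close> of pairs
  generates it. Two facts make \<open>B\<close> decide all three conditions.

  First, projective dimension one forces the relations in \<open>B\<close> to be independent: comparing
  \<open>S\<^sup>B \<rightarrow> S\<^sup>r \<rightarrow> I\<close> with a projective resolution of length one yields a linear projection of \<open>S\<^sup>B\<close>
  onto the kernel \<open>K\<close> of \<open>S\<^sup>B \<rightarrow> S\<^sup>r\<close>; irredundancy puts \<open>K\<close> inside \<open>m S\<^sup>B\<close>, where \<open>m\<close> is the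
  irrelevant ideal, so \<open>K = m K\<close>, and hence \<open>K = 0\<close> (\<open>minimal_kernel_zero\<close>). So
  \<open>0 \<rightarrow> S\<^sup>B \<rightarrow> S\<^sup>r \<rightarrow> I \<rightarrow> 0\<close> is a minimal graded free resolution (\<open>taylor_resolution\<close>). The degrees in
  homological degrees 0 and 1 do not depend on the minimal resolution
  (\<open>minimal_resolution_degrees_subset\<close>) and nothing lives above (\<open>minimal_resolution_length\<close>).
  Therefore linear relations and a linear resolution both say that every \<open>lcm(u\<^sub>p, u\<^sub>q)\<close> with
  \<open>(p, q) \<in> B\<close> has degree \<open>d + 1\<close>.

  Second, this condition is equivalent to linear quotients. If the colon ideals of an ordering are
  generated by variables, then induction along the ordering writes every Taylor syzygy in terms of
  the linear ones, so \<open>B\<close> can be chosen among those (\<open>linear_relations_of_quotients\<close>).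
  Conversely, view \<open>B\<close> as the edges of a graph on the generators; as a free basis of the syzygies it
  is a spanning tree. Order the generators by growing this tree one vertex at a time. If the new
  vertex \<open>i\<close> is attached to the old part by the edge \<open>{j, i}\<close>, then uniqueness of coefficients in a
  free module shows that this edge occurs in the expression of \<open>\<tau>\<^sub>l\<^sub>i\<close> for each old \<open>l\<close>, and by
  multidegrees \<open>lcm(u\<^sub>j, u\<^sub>i)\<close> divides \<open>lcm(u\<^sub>l, u\<^sub>i)\<close> (\<open>lcm_dvd_of_crossing\<close>). So the colon ideal at
  step \<open>i\<close> is generated by the monomial \<open>lcm(u\<^sub>j, u\<^sub>i) / u\<^sub>i\<close>, which is a variable because the
  lcm has degree \<open>d + 1\<close>.
\<close>

section \<open>Linear maps on free modules\<close>

abbreviation lookup where "lookup \<equiv> Poly_Mapping.lookup"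
abbreviation keys where "keys \<equiv> Poly_Mapping.keys"
abbreviation single where "single \<equiv> Poly_Mapping.single"

interpretation smult: module smult
  by (rule module_smult)

abbreviation linear_map :: "((nat \<Rightarrow>\<^sub>0 'a::comm_ring_1) \<Rightarrow> (nat \<Rightarrow>\<^sub>0 'a)) \<Rightarrow> bool" where
  "linear_map \<equiv> module_hom smult smult"

lemma linear_mapI:
  assumes "\<And>x y. f (x + y) = f x + f y" and "\<And>c x. f (smult c x) = smult c (f x)"
  shows "linear_map f"
  using assms by (simp add: module_hom_iff module_smult)

lemmas linear_map_add = module_hom.add[of smult smult]
lemmas linear_map_diff = module_hom.diff[of smult smult]
lemmas linear_map_scale = module_hom.scale[of smult smult]
lemmas linear_map_zero = module_hom.zero[of smult smult]
lemmas linear_map_sum = module_hom.sum[of smult smult]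

lemma linear_map_compose: "linear_map f \<Longrightarrow> linear_map g \<Longrightarrow> linear_map (\<lambda>x. f (g x))"
  using module_hom_compose[of smult smult g smult f] by (simp add: o_def)

lemma linear_map_minus: "linear_map f \<Longrightarrow> linear_map g \<Longrightarrow> linear_map (\<lambda>x. f x - g x)"
  by (rule linear_mapI)
    (simp_all add: linear_map_add linear_map_scale smult.scale_right_diff_distrib)

lemma lookup_basis_vec: "lookup (basis_vec k) l = (if k = l then 1 else 0)"
  by (simp add: basis_vec_def lookup_single when_def)

lemma single_eq_smult_basis_vec: "single k c = smult c (basis_vec k)"
  by (rule poly_mapping_eqI) (simp add: lookup_smult lookup_basis_vec lookup_single when_def)

lemma basis_expansion: "x = (\<Sum>k\<in>keys x. smult (lookup x k) (basis_vec k))"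
  by (rule poly_mapping_eqI)
    (auto simp: lookup_sum lookup_smult lookup_basis_vec if_distrib[of "(*) _"] sum.delta in_keys_iff cong: if_cong)

lemma linear_map_expansion:
  assumes "linear_map f"
  shows "f x = (\<Sum>k\<in>keys x. smult (lookup x k) (f (basis_vec k)))"
proof -
  have "f x = f (\<Sum>k\<in>keys x. smult (lookup x k) (basis_vec k))"
    using basis_expansion[of x] by simp
  then show ?thesis
    by (simp add: linear_map_sum[OF assms] linear_map_scale[OF assms])
qed

lemma linear_map_eqI:
  assumes "linear_map f" and "linear_map g"
    and "\<And>k. k \<in> keys x \<Longrightarrow> f (basis_vec k) = g (basis_vec k)"
  shows "f x = g x"
  using assms(3) linear_map_expansion[OF assms(1), of x] linear_map_expansion[OF assms(2), of x]
  by simp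

definition linear_extension :: "(nat \<Rightarrow> (nat \<Rightarrow>\<^sub>0 'a::comm_ring_1)) \<Rightarrow> (nat \<Rightarrow>\<^sub>0 'a) \<Rightarrow> (nat \<Rightarrow>\<^sub>0 'a)" where
  "linear_extension v x = (\<Sum>k\<in>keys x. smult (lookup x k) (v k))"

lemma keys_smult: "keys (smult c x) \<subseteq> keys x"
  by (auto simp: in_keys_iff lookup_smult)

lemma linear_extension_superset:
  assumes "finite A" and "keys x \<subseteq> A"
  shows "linear_extension v x = (\<Sum>k\<in>A. smult (lookup x k) (v k))"
  unfolding linear_extension_def
  using assms by (intro sum.mono_neutral_left) (auto simp: in_keys_iff)

lemma linear_map_extension: "linear_map (linear_extension v)"
proof (rule linear_mapI)
  fix x y :: "nat \<Rightarrow>\<^sub>0 'a"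
  have "keys (x + y) \<subseteq> keys x \<union> keys y" by (rule keys_add)
  then show "linear_extension v (x + y) = linear_extension v x + linear_extension v y"
    by (simp add: linear_extension_superset[of "keys x \<union> keys y"] lookup_add
        smult.scale_left_distrib sum.distrib)
next
  fix c and x :: "nat \<Rightarrow>\<^sub>0 'a"
  have "keys (smult c x) \<subseteq> keys x"
    by (rule keys_smult)
  then show "linear_extension v (smult c x) = smult c (linear_extension v x)"
    by (simp add: linear_extension_superset[of "keys x"] lookup_smult smult.scale_sum_right)
qed

lemma linear_extension_basis_vec [simp]: "linear_extension v (basis_vec k) = v k"
  by (subst linear_extension_superset[of "{k}"]) (auto simp: in_keys_iff lookup_basis_vec split: if_splits)

lemma basis_vec_in_free_module [simp]: "basis_vec k \<in> free_module r \<longleftrightarrow> k < r"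
  by (auto simp: free_module_def basis_vec_def)

lemma subspace_free_module: "smult.subspace (free_module r)"
proof (rule smult.subspaceI)
  show "x + y \<in> free_module r" if "x \<in> free_module r" "y \<in> free_module r"
    for x y :: "nat \<Rightarrow>\<^sub>0 'a"
    using that keys_add[of x y] by (auto simp: free_module_def)
  show "smult c x \<in> free_module r" if "x \<in> free_module r" for c and x :: "nat \<Rightarrow>\<^sub>0 'a"
    using that keys_smult[of c x] by (auto simp: free_module_def)
qed (simp add: free_module_def)

lemma linear_extension_in_subspace:
  "smult.subspace M \<Longrightarrow> (\<And>k. k \<in> keys x \<Longrightarrow> v k \<in> M) \<Longrightarrow> linear_extension v x \<in> M"
  by (auto simp: linear_extension_def intro!: smult.subspace_sum smult.subspace_scale)

lemma image_free_module_eq_span: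
  assumes "linear_map f"
  shows "f ` free_module r = smult.span (f ` basis_vec ` {..<r})"
proof
  show "f ` free_module r \<subseteq> smult.span (f ` basis_vec ` {..<r})"
  proof safe
    fix x :: "nat \<Rightarrow>\<^sub>0 'a" assume "x \<in> free_module r"
    then have "f (basis_vec k) \<in> f ` basis_vec ` {..<r}" if "k \<in> keys x" for k
      using that by (auto simp: free_module_def)
    then show "f x \<in> smult.span (f ` basis_vec ` {..<r})"
      by (subst linear_map_expansion[OF assms])
        (intro smult.span_sum smult.span_scale smult.span_base)
  qed
  show "smult.span (f ` basis_vec ` {..<r}) \<subseteq> f ` free_module r"
    by (rule smult.span_minimal[OF image_mono module_hom.subspace_image[OF assms subspace_free_module]])
      auto
qed

lemma projective_free_module: "projective (free_module r :: (nat \<Rightarrow>\<^sub>0 'a::comm_ring_1) set)"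
proof -
  let ?e = "linear_extension (\<lambda>k. if k < r then basis_vec k else 0) :: (nat \<Rightarrow>\<^sub>0 'a) \<Rightarrow> _"
  have fixed: "?e x = x" if "x \<in> free_module r" for x
  proof (rule linear_map_eqI[where g = "\<lambda>x. x", OF linear_map_extension smult.module_hom_ident])
    fix k assume "k \<in> keys x"
    then have "k < r" using that by (auto simp: free_module_def)
    then show "?e (basis_vec k) = basis_vec k" by simp
  qed
  have into: "?e x \<in> free_module r" for x
    by (rule linear_extension_in_subspace[OF subspace_free_module])
       (use smult.subspace_0[OF subspace_free_module] in auto)
  have "range ?e = free_module r"
  proof
    show "range ?e \<subseteq> free_module r" using into by blast
    show "free_module r \<subseteq> range ?e"
    proof
      fix x :: "nat \<Rightarrow>\<^sub>0 'a" assume "x \<in> free_module r"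
      then have "x = ?e x" by (simp only: fixed)
      then show "x \<in> range ?e" by (rule range_eqI)
    qed
  qed
  moreover have "?e \<circ> ?e = ?e" by (rule ext) (simp only: o_apply fixed into)
  ultimately show ?thesis
    unfolding projective_def by (intro exI[of _ ?e] conjI) (simp_all add: linear_map_extension)
qed

lemma subspace_projective: "projective P \<Longrightarrow> smult.subspace P"
  unfolding projective_def using module_hom.subspace_image[of smult smult _ UNIV] by auto

text \<open>
  Writing \<open>P\<close> as the image of an idempotent \<open>e\<close>, it suffices to lift \<open>f \<circ> e\<close> on the basis of the
  ambient free module, where values can be chosen freely.
\<close>
lemma projective_lift:
  assumes "projective P" and f: "linear_map f" and g: "linear_map g" and M: "smult.subspace M"
    and fP: "\<And>p. p \<in> P \<Longrightarrow> f p \<in> g ` M"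
  obtains h where "linear_map h" and "\<And>x. h x \<in> M" and "\<And>p. p \<in> P \<Longrightarrow> g (h p) = f p"
proof -
  obtain e where e: "linear_map e" "e \<circ> e = e" "P = range e"
    using \<open>projective P\<close> unfolding projective_def by blast
  have "\<exists>y. y \<in> M \<and> g y = f (e (basis_vec k))" for k
    using fP[of "e (basis_vec k)"] e(3) by force
  then obtain v where v: "\<And>k. v k \<in> M" "\<And>k. g (v k) = f (e (basis_vec k))"
    by metis
  have "g (linear_extension v x) = f (e x)" for x
    by (rule linear_map_eqI[where f = "\<lambda>x. g (linear_extension v x)" and g = "\<lambda>x. f (e x)"])
      (simp_all add: v linear_map_compose linear_map_extension f g e(1))
  moreover have "e p = p" if "p \<in> P" for p
    using that e(2,3) by (metis comp_apply imageE)
  ultimately show thesis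
    using v(1) by (intro that[of "linear_extension v"])
      (auto intro: linear_map_extension linear_extension_in_subspace[OF M])
qed

section \<open>Comparison of projective resolutions\<close>

text \<open>
  The first two steps of the comparison theorem: \<open>\<phi>, t\<close> is a chain map from \<open>Q\<close> to \<open>P\<close>, the maps
  \<open>\<psi>, g\<close> form a chain map back, and \<open>H\<close> is a homotopy from the identity of \<open>Q\<close> to their
  composition. In homological degree 1 the difference \<open>id - H \<circ> \<delta>' - g \<circ> t\<close> only has to land in the
  kernel of \<open>\<delta>'\<close>, so no further terms of the resolutions enter.
\<close>
lemma homotopy:
  assumes P: "projective P0" "projective P1" and Q: "projective Q0" "projective Q1"
    and lin: "linear_map \<epsilon>" "linear_map \<delta>" "linear_map \<epsilon>'" "linear_map \<delta>'" "linear_map \<phi>" "linear_map t"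
    and exP: "\<epsilon> ` P0 = J" "\<delta> ` P1 = {x \<in> P0. \<epsilon> x = 0}"
    and exQ: "\<epsilon>' ` Q0 = J" "\<delta>' ` Q1 = {x \<in> Q0. \<epsilon>' x = 0}"
    and \<phi>: "\<And>x. x \<in> Q0 \<Longrightarrow> \<phi> x \<in> P0" "\<And>x. x \<in> Q0 \<Longrightarrow> \<epsilon> (\<phi> x) = \<epsilon>' x"
    and t: "\<And>x. x \<in> Q1 \<Longrightarrow> t x \<in> P1" "\<And>x. x \<in> Q1 \<Longrightarrow> \<delta> (t x) = \<phi> (\<delta>' x)"
  obtains \<psi> g H where "linear_map \<psi>" "\<And>x. \<psi> x \<in> Q0"
    and "linear_map g" "\<And>x. g x \<in> Q1" and "linear_map H" "\<And>x. H x \<in> Q1"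
    and "\<And>x. x \<in> Q0 \<Longrightarrow> \<epsilon>' (x - \<psi> (\<phi> x)) = 0"
    and "\<And>x. x \<in> Q1 \<Longrightarrow> \<delta>' (x - H (\<delta>' x) - g (t x)) = 0"
proof -
  note sub = subspace_projective[OF Q(1)] subspace_projective[OF Q(2)]
  obtain \<psi> where \<psi>: "linear_map \<psi>" "\<And>x. \<psi> x \<in> Q0" "\<And>x. x \<in> P0 \<Longrightarrow> \<epsilon>' (\<psi> x) = \<epsilon> x"
    by (rule projective_lift[OF P(1) lin(1) lin(3) sub(1)]) (use exP exQ in auto)
  have chain: "\<epsilon>' (x - \<psi> (\<phi> x)) = 0" if "x \<in> Q0" for x
    using that \<phi> \<psi> by (simp add: linear_map_diff[OF lin(3)])
  have lin': "linear_map (\<lambda>x. x - \<psi> (\<phi> x))" "linear_map (\<lambda>x. \<psi> (\<delta> x))"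
    using linear_map_minus[OF smult.module_hom_ident linear_map_compose[OF \<psi>(1) lin(5)]]
      linear_map_compose[OF \<psi>(1) lin(2)] by simp_all
  obtain H where H: "linear_map H" "\<And>x. H x \<in> Q1" "\<And>x. x \<in> Q0 \<Longrightarrow> \<delta>' (H x) = x - \<psi> (\<phi> x)"
    by (rule projective_lift[OF Q(1) lin'(1) lin(4) sub(2)])
      (use chain exQ \<psi>(2) sub(1) in \<open>auto intro: smult.subspace_diff\<close>)
  have \<delta>P: "\<delta> x \<in> P0 \<and> \<epsilon> (\<delta> x) = 0" if "x \<in> P1" for x
    using that exP by auto
  have \<psi>\<delta>: "\<psi> (\<delta> x) \<in> \<delta>' ` Q1" if "x \<in> P1" for x
    using \<delta>P[OF that] \<psi> exQ(2) by simp
  obtain g where g: "linear_map g" "\<And>x. g x \<in> Q1" "\<And>x. x \<in> P1 \<Longrightarrow> \<delta>' (g x) = \<psi> (\<delta> x)"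
    by (rule projective_lift[OF P(2) lin'(2) lin(4) sub(2)]) (auto simp: \<psi>\<delta>)
  have htpy: "\<delta>' (x - H (\<delta>' x) - g (t x)) = 0" if "x \<in> Q1" for x
  proof -
    have "\<delta>' x \<in> Q0" using that exQ by auto
    then show ?thesis
      using that H g t by (simp add: linear_map_diff[OF lin(4)])
  qed
  show thesis by (rule that[OF \<psi>(1,2) g(1,2) H(1,2) chain htpy])
qed

text \<open>
  Lift first along \<open>\<epsilon>\<close>, then along \<open>\<delta>\<close>; exactness of \<open>P\<close> puts \<open>\<phi> \<circ> \<delta>'\<close> into the image of \<open>\<delta>\<close>.
\<close>
lemma chain_map:
  assumes Q: "projective Q0" "projective Q1" and P: "smult.subspace P0" "smult.subspace P1"
    and lin: "linear_map \<epsilon>" "linear_map \<delta>" "linear_map \<epsilon>'" "linear_map \<delta>'"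
    and exP: "\<epsilon> ` P0 = J" "\<delta> ` P1 = {x \<in> P0. \<epsilon> x = 0}"
    and exQ: "\<epsilon>' ` Q0 = J" "\<delta>' ` Q1 = {x \<in> Q0. \<epsilon>' x = 0}"
  obtains \<phi> t where "linear_map \<phi>" "\<And>x. \<phi> x \<in> P0" "\<And>x. x \<in> Q0 \<Longrightarrow> \<epsilon> (\<phi> x) = \<epsilon>' x"
    and "linear_map t" "\<And>x. t x \<in> P1" "\<And>x. x \<in> Q1 \<Longrightarrow> \<delta> (t x) = \<phi> (\<delta>' x)"
proof -
  obtain \<phi> where \<phi>: "linear_map \<phi>" "\<And>x. \<phi> x \<in> P0" "\<And>x. x \<in> Q0 \<Longrightarrow> \<epsilon> (\<phi> x) = \<epsilon>' x"
    by (rule projective_lift[OF Q(1) lin(3) lin(1) P(1)]) (use exP exQ in auto)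
  have "\<delta>' x \<in> Q0 \<and> \<epsilon>' (\<delta>' x) = 0" if "x \<in> Q1" for x
    using that exQ by auto
  then have \<phi>\<delta>: "\<phi> (\<delta>' x) \<in> \<delta> ` P1" if "x \<in> Q1" for x
    using that \<phi> exP(2) by simp
  obtain t where t: "linear_map t" "\<And>x. t x \<in> P1" "\<And>x. x \<in> Q1 \<Longrightarrow> \<delta> (t x) = \<phi> (\<delta>' x)"
    by (rule projective_lift[OF Q(2) linear_map_compose[OF \<phi>(1) lin(4)] lin(2) P(2)]) (auto simp: \<phi>\<delta>)
  show thesis by (rule that[OF \<phi> t])
qed

section \<open>Exponent vectors and monomial ideals\<close>

definition expo_dvd :: "'n expo \<Rightarrow> 'n expo \<Rightarrow> bool" (infix \<open>\<preceq>\<close> 50) where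
  "u \<preceq> w \<longleftrightarrow> (\<forall>i. lookup u i \<le> lookup w i)"

lemma expo_dvd_minus_add: "u \<preceq> w \<Longrightarrow> (w - u) + u = w"
  by (rule poly_mapping_eqI) (simp add: expo_dvd_def lookup_add lookup_minus)

lemma expo_dvd_iff: "u \<preceq> w \<longleftrightarrow> (\<exists>v. w = v + u)"
proof
  show "u \<preceq> w \<Longrightarrow> \<exists>v. w = v + u" by (metis expo_dvd_minus_add)
qed (auto simp: expo_dvd_def lookup_add)

lemma expo_dvd_add: "u \<preceq> v + u"
  by (auto simp: expo_dvd_iff)

lemma expo_dvd_refl: "u \<preceq> u"
  by (simp add: expo_dvd_def)

lemma expo_dvd_trans: "u \<preceq> v \<Longrightarrow> v \<preceq> w \<Longrightarrow> u \<preceq> w"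
  unfolding expo_dvd_def using le_trans by blast

lemma expo_add_eq_0: "u + v = 0 \<Longrightarrow> u = 0 \<and> v = (0 :: 'n expo)"
  by (auto simp: poly_mapping_eq_iff lookup_add fun_eq_iff)

lemma expo_deg_0 [simp]: "expo_deg 0 = 0"
  by (simp add: expo_deg_def)

lemma expo_deg_add: "expo_deg (u + v) = expo_deg u + expo_deg v"
  by (simp add: expo_deg_def lookup_add sum.distrib)

lemma expo_deg_eq_0_iff [simp]: "expo_deg u = 0 \<longleftrightarrow> u = 0"
  by (auto simp: expo_deg_def poly_mapping_eq_iff fun_eq_iff)

lemma expo_dvd_deg_le: "u \<preceq> w \<Longrightarrow> expo_deg u \<le> expo_deg w"
  by (auto simp: expo_dvd_def expo_deg_def intro: sum_mono)

text \<open>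
  The quotient of the two monomials has degree 0.
\<close>
lemma expo_dvd_same_deg: "u \<preceq> w \<Longrightarrow> expo_deg u = expo_deg w \<Longrightarrow> u = w"
  using expo_deg_add[of "w - u" u] expo_dvd_minus_add[of u w]
  by (metis add_0 add_cancel_left_left expo_deg_eq_0_iff)

lemma monomial_expansion: "p = (\<Sum>v\<in>keys p. single v (lookup p v))"
  by (rule poly_mapping_eqI)
    (auto simp: lookup_sum lookup_single when_def in_keys_iff sum.delta)

lemma in_keys_mult_monomial:
  fixes f :: "('n, 'k::comm_ring_1) mpoly"
  assumes "w \<in> keys (f * monomial u)"
  obtains v where "v \<in> keys f" and "w = v + u"
  using assms keys_mult[of f "monomial u"] by (auto simp: monomial_def split: if_splits)

lemma lookup_mult_monomial:
  fixes f :: "('n, 'k::comm_ring_1) mpoly"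
  shows "lookup (f * monomial u) (v + u) = lookup f v"
proof -
  have "f * monomial u = (\<Sum>w\<in>keys f. single (w + u) (lookup f w))"
    by (subst monomial_expansion[of f])
      (simp add: sum_distrib_right monomial_def mult_single)
  then show ?thesis
    by (auto simp: lookup_sum lookup_single when_def in_keys_iff sum.delta)
qed

text \<open>
  Membership in a monomial ideal is decided term by term. This reduces every question about ideals
  below to divisibility of exponent vectors.
\<close>
lemma ideal_of_monomials_iff:
  fixes f :: "('n, 'k::comm_ring_1) mpoly"
  shows "f \<in> ideal_of (monomial ` U) \<longleftrightarrow> (\<forall>w\<in>keys f. \<exists>u\<in>U. u \<preceq> w)"
proof
  interpret M: module "(*) :: ('n, 'k) mpoly \<Rightarrow> _" by (rule module_mult)
  let ?T = "{f :: ('n, 'k) mpoly. \<forall>w\<in>keys f. \<exists>u\<in>U. u \<preceq> w}"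
  have "M.subspace ?T"
  proof (rule M.subspaceI)
    fix c f :: "('n, 'k) mpoly" assume f: "f \<in> ?T"
    have "\<exists>u\<in>U. u \<preceq> w" if "w \<in> keys (c * f)" for w
    proof -
      obtain a b where "w = a + b" "b \<in> keys f"
        using \<open>w \<in> keys (c * f)\<close> keys_mult[of c f] by auto
      then show ?thesis using f expo_dvd_add expo_dvd_trans by blast
    qed
    then show "c * f \<in> ?T" by blast
  next
    fix f g :: "('n, 'k) mpoly" assume "f \<in> ?T" "g \<in> ?T"
    then show "f + g \<in> ?T" using keys_add[of f g] by blast
  qed simp
  moreover have "monomial u \<in> ?T" if "u \<in> U" for u
    using that expo_dvd_refl[of u] by (auto simp: monomial_def split: if_splits)
  ultimately have "M.span (monomial ` U) \<subseteq> ?T"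
    by (intro M.span_minimal) blast+
  then show "f \<in> M.span (monomial ` U) \<Longrightarrow> \<forall>w\<in>keys f. \<exists>u\<in>U. u \<preceq> w" by blast
  assume *: "\<forall>w\<in>keys f. \<exists>u\<in>U. u \<preceq> w"
  have "single w (lookup f w) \<in> M.span (monomial ` U)" if w: "w \<in> keys f" for w
  proof -
    obtain u where u: "u \<in> U" "u \<preceq> w" using * w by blast
    have "single w (lookup f w) = single (w - u) (lookup f w) * monomial u"
      by (simp add: monomial_def mult_single expo_dvd_minus_add u)
    then show ?thesis using u by (auto intro: M.span_scale M.span_base)
  qed
  then show "f \<in> M.span (monomial ` U)"
    by (subst monomial_expansion) (rule M.span_sum)
qed

lemma ideal_of_vars_iff:
  fixes f :: "('n, 'k::comm_ring_1) mpoly"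
  shows "f \<in> ideal_of (var ` X) \<longleftrightarrow> (\<forall>w\<in>keys f. \<exists>i\<in>X. 0 < lookup w i)"
proof -
  have "var ` X = (monomial ` (\<lambda>i. single i 1) ` X :: ('n, 'k) mpoly set)"
    by (simp add: image_image var_def)
  then show ?thesis
    by (simp add: ideal_of_monomials_iff)
      (auto simp: expo_dvd_def lookup_single when_def Suc_le_eq)
qed

lemma in_irrelevant_ideal_iff:
  fixes f :: "('n, 'k::comm_ring_1) mpoly"
  shows "f \<in> ideal_of (range var) \<longleftrightarrow> lookup f 0 = 0"
proof -
  have "(\<exists>i. 0 < lookup w i) \<longleftrightarrow> w \<noteq> 0" for w :: "'n expo"
    by (auto simp: poly_mapping_eq_iff fun_eq_iff)
  then show ?thesis by (auto simp: ideal_of_vars_iff in_keys_iff)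
qed

section \<open>Powers of the irrelevant ideal\<close>

text \<open>
  Membership of all coordinates in the \<open>N\<close>-th power of the irrelevant ideal, expressed through the
  degrees of the terms.
\<close>
definition order_at_least :: "nat \<Rightarrow> (nat \<Rightarrow>\<^sub>0 ('n::finite, 'k::comm_ring_1) mpoly) \<Rightarrow> bool" where
  "order_at_least N x \<longleftrightarrow> (\<forall>k. \<forall>v\<in>keys (lookup x k). N \<le> expo_deg v)"

lemma order_at_least_1_iff: "order_at_least 1 x \<longleftrightarrow> (\<forall>k. lookup (lookup x k) 0 = 0)"
proof -
  have "1 \<le> expo_deg v \<longleftrightarrow> v \<noteq> 0" for v :: "'a expo"
    using expo_deg_eq_0_iff[of v] by linarith
  then show ?thesis unfolding order_at_least_def by (metis in_keys_iff)
qed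

lemma in_keys_linear_map:
  assumes "linear_map f" and "v \<in> keys (lookup (f x) l)"
  obtains k a b where "k \<in> keys x" and "a \<in> keys (lookup x k)"
    and "b \<in> keys (lookup (f (basis_vec k)) l)" and "v = a + b"
proof -
  have "lookup (lookup (f x) l) v =
      (\<Sum>k\<in>keys x. lookup (lookup x k * lookup (f (basis_vec k)) l) v)"
    by (subst linear_map_expansion[OF assms(1)]) (simp add: lookup_sum lookup_smult)
  then obtain k where k: "k \<in> keys x" "v \<in> keys (lookup x k * lookup (f (basis_vec k)) l)"
    using assms(2) by (auto simp: in_keys_iff elim: sum.not_neutral_contains_not_neutral)
  then show thesis using keys_mult[of "lookup x k" "lookup (f (basis_vec k)) l"] that by blast
qed

lemma order_at_least_linear_map:
  assumes "linear_map f" and "order_at_least N x" and "\<And>k. k \<in> keys x \<Longrightarrow> order_at_least M (f (basis_vec k))"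
  shows "order_at_least (N + M) (f x)"
  unfolding order_at_least_def
proof (intro allI ballI)
  fix l v assume "v \<in> keys (lookup (f x) l)"
  then obtain k a b where "k \<in> keys x" "a \<in> keys (lookup x k)"
    "b \<in> keys (lookup (f (basis_vec k)) l)" "v = a + b"
    by (rule in_keys_linear_map[OF assms(1)])
  then show "N + M \<le> expo_deg v"
    using assms(2,3) unfolding order_at_least_def by (metis add_mono expo_deg_add)
qed

lemma order_at_least_0 [simp]: "order_at_least 0 x"
  by (simp add: order_at_least_def)

text \<open>
  A form of Nakayama's lemma that works for modules without any finiteness: since \<open>e\<close> raises the
  order by at least one, the fixed vector \<open>x = e x = e (e x) = \<dots>\<close> has arbitrarily large order.
\<close>
lemma fixed_vector_zero:
  assumes e: "linear_map e" and e1: "\<And>y. y \<in> free_module s \<Longrightarrow> order_at_least 1 (e y)"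
    and x: "x \<in> free_module s" "e x = x"
  shows "x = 0"
proof -
  have ord: "order_at_least N x" for N
  proof (induction N)
    case (Suc N)
    have "order_at_least (N + 1) (e x)"
    proof (rule order_at_least_linear_map[OF e Suc])
      fix k assume "k \<in> keys x"
      then have "k < s" using x(1) by (auto simp: free_module_def)
      then show "order_at_least 1 (e (basis_vec k))" by (intro e1) simp
    qed
    then show ?case using x by simp
  qed simp
  have "lookup x k = 0" for k
  proof (rule ccontr)
    assume "lookup x k \<noteq> 0"
    then obtain v where "v \<in> keys (lookup x k)"
      by (auto simp: poly_mapping_eq_iff fun_eq_iff in_keys_iff)
    then show False using ord[of "Suc (expo_deg v)"] by (force simp: order_at_least_def)
  qed
  then show ?thesis by (intro poly_mapping_eqI) simp
qed

section \<open>Gradings of free modules\<close>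

lemma single_sum: "single k (sum g A) = (\<Sum>i\<in>A. single k (g i))"
  by (induction A rule: infinite_finite_induct) (simp_all add: single_add)

lemma vector_induct [case_names zero add monomial]:
  fixes x :: "nat \<Rightarrow>\<^sub>0 ('n, 'k::comm_ring_1) mpoly"
  assumes "P 0" and "\<And>x y. P x \<Longrightarrow> P y \<Longrightarrow> P (x + y)"
    and "\<And>k v c. k \<in> keys x \<Longrightarrow> P (single k (single v c))"
  shows "P x"
proof -
  have sumP: "(\<And>i. i \<in> A \<Longrightarrow> P (g i)) \<Longrightarrow> P (sum g A)" for A and g :: "'i \<Rightarrow> _"
    by (induction A rule: infinite_finite_induct) (simp_all add: assms)
  have "P (single k p)" if "k \<in> keys x" for k p
  proof -
    have "P (single k (\<Sum>v\<in>keys p. single v (lookup p v)))"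
      unfolding single_sum by (rule sumP) (rule assms(3)[OF that])
    then show ?thesis by (simp flip: monomial_expansion)
  qed
  moreover have "x = (\<Sum>k\<in>keys x. single k (lookup x k))"
    by (rule poly_mapping_eqI)
      (auto simp: lookup_sum lookup_single when_def in_keys_iff sum.delta)
  ultimately show ?thesis using sumP[of "keys x" "\<lambda>k. single k (lookup x k)"] by simp
qed

text \<open>
  The grading of the polynomial ring by an additive function on monomials. It is used for the total
  degree and for the finest grading, where the degree of a monomial is its exponent vector. A free
  module is graded by the shifts \<open>as\<close> of its basis vectors.
\<close>
locale grading =
  fixes deg :: "'n expo \<Rightarrow> 'g::cancel_comm_monoid_add"
  assumes deg_add: "deg (u + v) = deg u + deg v"
begin

lemma deg_0: "deg 0 = 0"
  using deg_add[of 0 0] by simp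

definition homog :: "(nat \<Rightarrow> 'g) \<Rightarrow> 'g \<Rightarrow> (nat \<Rightarrow>\<^sub>0 ('n, 'k::comm_ring_1) mpoly) \<Rightarrow> bool" where
  "homog as m x \<longleftrightarrow> (\<forall>k. \<forall>v\<in>keys (lookup x k). deg v + as k = m)"

definition part :: "(nat \<Rightarrow> 'g) \<Rightarrow> 'g \<Rightarrow> (nat \<Rightarrow>\<^sub>0 ('n, 'k::comm_ring_1) mpoly) \<Rightarrow>
    (nat \<Rightarrow>\<^sub>0 ('n, 'k) mpoly)" where
  "part as m x = Poly_Mapping.mapp (\<lambda>k. Poly_Mapping.mapp (\<lambda>v c. c when deg v + as k = m)) x"

lemma lookup_part:
  "lookup (lookup (part as m x) k) v = (if deg v + as k = m then lookup (lookup x k) v else 0)"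
  by (auto simp: part_def lookup_mapp when_def in_keys_iff)

lemma vector_eqI: "(\<And>k v. lookup (lookup x k) v = lookup (lookup y k) v) \<Longrightarrow> x = y"
  by (intro poly_mapping_eqI) simp

lemma part_add: "part as m (x + y) = part as m x + part as m y"
  by (rule vector_eqI) (simp add: lookup_part lookup_add)

lemma part_0 [simp]: "part as m 0 = 0"
  by (rule vector_eqI) (simp add: lookup_part)

lemma homog_part: "homog as m (part as m x)"
  by (auto simp: homog_def in_keys_iff lookup_part split: if_splits)

lemma part_homog: "homog as m x \<Longrightarrow> part as m' x = (if m' = m then x else 0)"
proof (rule vector_eqI)
  fix k v assume "homog as m x"
  then have "lookup (lookup x k) v \<noteq> 0 \<Longrightarrow> deg v + as k = m"
    by (simp add: homog_def in_keys_iff)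
  then show "lookup (lookup (part as m' x) k) v = lookup (lookup (if m' = m then x else 0) k) v"
    by (auto simp: lookup_part)
qed

lemma part_in_free_module: "x \<in> free_module r \<Longrightarrow> part as m x \<in> free_module r"
  using keys_mapp_subset unfolding part_def free_module_def by fastforce

lemma homog_smult: "homog as m x \<Longrightarrow> homog as (deg v + m) (smult (single v c) x)"
  unfolding homog_def
proof (intro allI ballI)
  fix k w assume x: "\<forall>k. \<forall>v\<in>keys (lookup x k). deg v + as k = m"
    and w: "w \<in> keys (lookup (smult (single v c) x) k)"
  then obtain b where "w = v + b" "b \<in> keys (lookup x k)"
    using keys_mult[of "single v c" "lookup x k"] by (auto simp: lookup_smult split: if_splits)
  then show "deg w + as k = deg v + m"
    using x by (auto simp: deg_add add.assoc)
qed

lemma homog_basis_vec: "homog as (as k) (basis_vec k)"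
  by (auto simp: homog_def lookup_basis_vec deg_0)

text \<open>
  Both sides are additive in \<open>x\<close>, so it is enough to look at a monomial multiple of a basis vector;
  such a vector is homogeneous, and so is its image.
\<close>
lemma part_linear_map:
  fixes f :: "(nat \<Rightarrow>\<^sub>0 ('n, 'k::comm_ring_1) mpoly) \<Rightarrow> (nat \<Rightarrow>\<^sub>0 ('n, 'k) mpoly)"
  assumes f: "linear_map f" and hom: "\<And>k. k < s \<Longrightarrow> homog as (bs k) (f (basis_vec k))"
    and x: "x \<in> free_module s"
  shows "f (part bs m x) = part as m (f x)"
proof (induction x rule: vector_induct)
  case zero
  then show ?case by (simp add: linear_map_zero[OF f])
next
  case (add x y)
  then show ?case by (simp add: linear_map_add[OF f] part_add)
next
  case (monomial k v c)
  then have "k < s" using x by (auto simp: free_module_def)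
  have eq: "single k (single v c) = smult (single v c) (basis_vec k)"
    by (rule single_eq_smult_basis_vec)
  have "homog bs (deg v + bs k) (single k (single v c))"
    unfolding eq by (intro homog_smult homog_basis_vec)
  moreover have "homog as (deg v + bs k) (f (single k (single v c)))"
    unfolding eq linear_map_scale[OF f] by (intro homog_smult hom \<open>k < s\<close>)
  ultimately show ?case
    by (simp add: part_homog linear_map_zero[OF f])
qed

lemma homog_linear_map:
  assumes "linear_map f" and "\<And>k. k < s \<Longrightarrow> homog as (bs k) (f (basis_vec k))"
    and "x \<in> free_module s" and "homog bs m x"
  shows "homog as m (f x)"
  using part_linear_map[OF assms(1-3), of m] homog_part[of as m "f x"]
  by (simp add: part_homog[OF assms(4)])

text \<open>
  Take any lift on a basis vector and keep its homogeneous part of the right degree; this is again a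
  lift by \<open>part_linear_map\<close>.
\<close>
lemma homog_lift:
  assumes f: "linear_map f" and g: "linear_map g"
    and fg: "\<And>k. k < s \<Longrightarrow> f (basis_vec k) \<in> g ` free_module t"
    and hom: "\<And>k. k < s \<Longrightarrow> homog cs (bs k) (f (basis_vec k))"
      "\<And>k. k < t \<Longrightarrow> homog cs (as k) (g (basis_vec k))"
  obtains h where "linear_map h" and "\<And>x. h x \<in> free_module t"
    and "\<And>x. x \<in> free_module s \<Longrightarrow> g (h x) = f x"
    and "\<And>k. k < s \<Longrightarrow> homog as (bs k) (h (basis_vec k))"
proof -
  have "\<exists>y. y \<in> free_module t \<and> homog as (bs k) y \<and> (k < s \<longrightarrow> g y = f (basis_vec k))" for k
  proof (cases "k < s")
    case True
    then obtain y where y: "y \<in> free_module t" "g y = f (basis_vec k)" using fg by force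
    have "g (part as (bs k) y) = part cs (bs k) (f (basis_vec k))"
      using part_linear_map[OF g hom(2) y(1)] y(2) by simp
    then show ?thesis
      using part_in_free_module[OF y(1)] homog_part part_homog[OF hom(1)[OF True]] by metis
  next
    case False
    have "homog as (bs k) 0" by (simp add: homog_def)
    then show ?thesis using False smult.subspace_0[OF subspace_free_module] by blast
  qed
  then obtain v where v: "\<And>k. v k \<in> free_module t" "\<And>k. homog as (bs k) (v k)"
    "\<And>k. k < s \<Longrightarrow> g (v k) = f (basis_vec k)"
    by metis
  let ?h = "linear_extension v"
  have "g (?h x) = f x" if "x \<in> free_module s" for x
    by (rule linear_map_eqI[OF linear_map_compose[OF g linear_map_extension] f])
      (use that v in \<open>auto simp: free_module_def\<close>)
  then show thesis
    using v by (intro that[of ?h])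
      (auto intro: linear_map_extension linear_extension_in_subspace[OF subspace_free_module])
qed

end

section \<open>Minimal graded free resolutions\<close>

interpretation total: grading expo_deg
  by unfold_locales (rule expo_deg_add)

interpretation multi: grading "\<lambda>u. u"
  by unfold_locales simp

lemma smult_single: "smult c (single k y) = single k (c * y)"
  by (rule poly_mapping_eqI) (simp add: lookup_smult lookup_single when_def)

text \<open>
  A homomorphism to the ring is regarded as a linear map to the free module of rank one, so that
  augmentations and differentials are treated alike.
\<close>
lemma linear_map_of_functional:
  assumes "module_hom smult (*) \<epsilon>"
  shows "linear_map (\<lambda>x. single 0 (\<epsilon> x))"
  using module_hom.add[OF assms] module_hom.scale[OF assms]
  by (intro linear_mapI) (simp_all add: single_add smult_single)

lemma single_eq_0_iff [simp]: "single k c = 0 \<longleftrightarrow> c = 0"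
  by (metis lookup_single_eq lookup_zero single_zero)

lemma is_resolutionD:
  assumes "is_resolution I P \<epsilon> \<delta>"
  shows "linear_map (\<lambda>x. single 0 (\<epsilon> x))" and "linear_map (\<delta> i)"
    and "(\<lambda>x. single 0 (\<epsilon> x)) ` P 0 = single 0 ` I"
    and "\<delta> 0 ` P 1 = {x \<in> P 0. single 0 (\<epsilon> x) = (0 :: nat \<Rightarrow>\<^sub>0 _)}"
    and "\<delta> (Suc i) ` P (Suc (Suc i)) = {x \<in> P (Suc i). \<delta> i x = 0}"
  using assms unfolding is_resolution_def by (auto simp: linear_map_of_functional)

text \<open>
  Comparison with the resolution \<open>P\<close> of length one gives the linear map \<open>id - H \<circ> D - g \<circ> t\<close> on
  \<open>free_module s\<close>. It sends everything into the kernel of \<open>D\<close>, and it fixes that kernel pointwise,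
  because \<open>t\<close> vanishes there by injectivity of \<open>P 1 \<rightarrow> P 0\<close>. As the kernel lies in the irrelevant
  ideal times \<open>free_module s\<close>, \<open>fixed_vector_zero\<close> applies.
\<close>
lemma minimal_kernel_zero:
  fixes I :: "('n::finite, 'k::comm_ring_1) mpoly set"
  assumes "has_projective_resolution_of_length I 1"
    and lin: "linear_map E" "linear_map D"
    and ex: "E ` free_module r = single 0 ` I" "D ` free_module s = {x \<in> free_module r. E x = 0}"
    and min: "\<And>x. x \<in> free_module s \<Longrightarrow> D x = 0 \<Longrightarrow> order_at_least 1 x"
    and x: "x \<in> free_module s" "D x = 0"
  shows "x = 0"
proof -
  obtain P \<epsilon> \<delta> where res: "is_resolution I P \<epsilon> \<delta>" and proj: "\<And>i. projective (P i)" and "\<forall>i>1. P i = {0}"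
    using assms(1) unfolding has_projective_resolution_of_length_def by blast
  note res = is_resolutionD[OF res]
  have inj: "y = 0" if "y \<in> P 1" "\<delta> 0 y = 0" for y
  proof -
    have "y \<in> \<delta> 1 ` P 2" using res(5)[of 0] that by (simp add: numeral_2_eq_2)
    moreover have "P 2 = {0}" using \<open>\<forall>i>1. P i = {0}\<close> by simp
    ultimately show ?thesis using linear_map_zero[OF res(2)] by auto
  qed
  note free = projective_free_module[of r] projective_free_module[of s]
  obtain \<phi> t where \<phi>: "linear_map \<phi>" "\<And>x. \<phi> x \<in> P 0"
      "\<And>x. x \<in> free_module r \<Longrightarrow> single 0 (\<epsilon> (\<phi> x)) = E x"
    and t: "linear_map t" "\<And>x. t x \<in> P 1" "\<And>x. x \<in> free_module s \<Longrightarrow> \<delta> 0 (t x) = \<phi> (D x)"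
    by (rule chain_map[OF free subspace_projective[OF proj] subspace_projective[OF proj]
        res(1) res(2) lin res(3) res(4) ex]) auto
  obtain \<psi> g H where \<psi>: "linear_map \<psi>" "\<And>x. \<psi> x \<in> free_module r" and g: "linear_map g" "\<And>x. g x \<in> free_module s"
    and H: "linear_map H" "\<And>x. H x \<in> free_module s"
    and h0: "\<And>x. x \<in> free_module r \<Longrightarrow> E (x - \<psi> (\<phi> x)) = 0"
    and htpy: "\<And>x. x \<in> free_module s \<Longrightarrow> D (x - H (D x) - g (t x)) = 0"
    by (rule homotopy[OF proj proj free res(1) res(2) lin \<phi>(1) t(1) res(3) res(4) ex \<phi>(2,3) t(2,3)]) auto
  show ?thesis
  proof (rule fixed_vector_zero)
    show "linear_map (\<lambda>x. x - H (D x) - g (t x))"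
      by (rule linear_map_minus[OF linear_map_minus[OF smult.module_hom_ident
              linear_map_compose[OF H(1) lin(2)]] linear_map_compose[OF g(1) t(1)]])
    show "order_at_least 1 (y - H (D y) - g (t y))" if "y \<in> free_module s" for y
      using that htpy g(2) H(2)
      by (intro min smult.subspace_diff[OF subspace_free_module]) auto
    have "t x = 0" using inj[OF t(2)] t(3)[OF x(1)] x(2) linear_map_zero[OF \<phi>(1)] by simp
    then show "x - H (D x) - g (t x) = x"
      using x(2) linear_map_zero[OF H(1)] linear_map_zero[OF g(1)] by simp
  qed (rule x(1))
qed

lemma minimal_graded_free_resolutionD:
  assumes "minimal_graded_free_resolution I a \<epsilon> \<delta>"
  shows "is_resolution I (\<lambda>i. free_module (length (a i))) \<epsilon> \<delta>"
    and "k < length (a 0) \<Longrightarrow> total.homog (\<lambda>_. 0) (a 0 ! k) (single 0 (\<epsilon> (basis_vec k)) :: nat \<Rightarrow>\<^sub>0 _)"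
    and "k < length (a (Suc i)) \<Longrightarrow> total.homog (\<lambda>l. a i ! l) (a (Suc i) ! k) (\<delta> i (basis_vec k))"
    and "x \<in> free_module (length (a (Suc i))) \<Longrightarrow> order_at_least 1 (\<delta> i x)"
proof -
  note assms = assms[unfolded minimal_graded_free_resolution_def]
  show "is_resolution I (\<lambda>i. free_module (length (a i))) \<epsilon> \<delta>" using assms by blast
  show "total.homog (\<lambda>_. 0) (a 0 ! k) (single 0 (\<epsilon> (basis_vec k)) :: nat \<Rightarrow>\<^sub>0 _)" if "k < length (a 0)"
    using assms that unfolding total.homog_def homogeneous_def by (auto simp: lookup_single when_def)
  show "total.homog (\<lambda>l. a i ! l) (a (Suc i) ! k) (\<delta> i (basis_vec k))" if "k < length (a (Suc i))"
  proof -
    have "graded_elem (a i) (a (Suc i) ! k) (\<delta> i (basis_vec k))" using assms that by blast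
    then show ?thesis
      unfolding graded_elem_def total.homog_def free_module_def
      by (auto simp: in_keys_iff) (metis in_keys_iff lessThan_iff lookup_zero subset_iff)
  qed
  show "order_at_least 1 (\<delta> i x)" if "x \<in> free_module (length (a (Suc i)))"
    using assms that unfolding order_at_least_1_iff by (auto simp: in_irrelevant_ideal_iff)
qed

lemma not_order_at_least_1_basis_vec: "\<not> order_at_least 1 (basis_vec k)"
  unfolding order_at_least_1_iff by (metis lookup_basis_vec lookup_one_zero zero_neq_one)

text \<open>
  The differential in homological degree 0 is injective by \<open>minimal_kernel_zero\<close>, so the next one is
  zero; exactness then makes a free module equal to the image of the following differential, which
  contains no basis vector by minimality. The same step repeats in all higher degrees.
\<close>
lemma minimal_resolution_length:
  fixes I :: "('n::finite, 'k::field) mpoly set"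
  assumes "has_projective_resolution_of_length I 1" and min: "minimal_graded_free_resolution I a \<epsilon> \<delta>"
  shows "a (Suc (Suc i)) = []"
proof -
  note minD = minimal_graded_free_resolutionD[OF min]
  note res = is_resolutionD[OF minD(1)]
  have nil: "a (Suc (Suc i)) = []"
    if zero: "\<And>x :: nat \<Rightarrow>\<^sub>0 ('n, 'k) mpoly. x \<in> free_module (length (a (Suc (Suc i)))) \<Longrightarrow> \<delta> (Suc i) x = 0" for i
  proof (rule ccontr)
    assume "a (Suc (Suc i)) \<noteq> []"
    then have b: "(basis_vec 0 :: nat \<Rightarrow>\<^sub>0 ('n, 'k) mpoly) \<in> free_module (length (a (Suc (Suc i))))" by simp
    with zero have "(basis_vec 0 :: nat \<Rightarrow>\<^sub>0 ('n, 'k) mpoly) \<in> \<delta> (Suc (Suc i)) ` free_module (length (a (Suc (Suc (Suc i)))))"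
      unfolding res(5) by simp
    then show False using minD(4) not_order_at_least_1_basis_vec by (metis imageE)
  qed
  have inj: "x = 0" if x: "x \<in> free_module (length (a 1))" "\<delta> 0 x = 0"
    for x :: "nat \<Rightarrow>\<^sub>0 ('n, 'k) mpoly"
  proof (rule minimal_kernel_zero[OF assms(1) res(1,2,3,4) _ x])
    fix y :: "nat \<Rightarrow>\<^sub>0 ('n, 'k) mpoly"
    assume "y \<in> free_module (length (a 1))" "\<delta> 0 y = 0"
    then have "y \<in> \<delta> (Suc 0) ` free_module (length (a (Suc (Suc 0))))"
      unfolding res(5) by simp
    then show "order_at_least 1 y" using minD(4) by blast
  qed
  show ?thesis
  proof (induction i)
    case 0
    show ?case
    proof (rule nil)
      fix x :: "nat \<Rightarrow>\<^sub>0 ('n, 'k) mpoly"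
      assume "x \<in> free_module (length (a (Suc (Suc 0))))"
      then have "\<delta> (Suc 0) x \<in> {x \<in> free_module (length (a (Suc 0))). \<delta> 0 x = 0}"
        unfolding res(5)[symmetric] by (rule imageI)
      then show "\<delta> (Suc 0) x = 0" using inj by simp
    qed
  next
    case (Suc i)
    show ?case
    proof (rule nil)
      fix x :: "nat \<Rightarrow>\<^sub>0 ('n, 'k) mpoly"
      assume "x \<in> free_module (length (a (Suc (Suc (Suc i)))))"
      then have "\<delta> (Suc (Suc i)) x \<in> {x \<in> free_module (length (a (Suc (Suc i)))). \<delta> (Suc i) x = 0}"
        unfolding res(5)[symmetric] by (rule imageI)
      then show "\<delta> (Suc (Suc i)) x = 0" by (simp add: Suc free_module_def in_keys_iff)
    qed
  qed
qed

text \<open>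
  A coefficient with nonzero constant term can only come from coefficients with nonzero constant
  term, and in a homogeneous vector such coefficients sit at basis vectors of the same degree.
\<close>
lemma (in grading) degree_from_unit_entry:
  assumes "linear_map f" and "x \<in> free_module s" and "homog as m x"
    and "lookup (lookup (f x) l) 0 \<noteq> 0"
  obtains k where "k < s" and "as k = m"
proof -
  have "0 \<in> keys (lookup (f x) l)" using assms(4) by (simp add: in_keys_iff)
  then obtain k a b where k: "k \<in> keys x" "a \<in> keys (lookup x k)" "0 = a + b"
    by (rule in_keys_linear_map[OF assms(1)])
  then have "a = 0" using expo_add_eq_0[of a b] by simp
  then have "deg 0 + as k = m" using k assms(3) unfolding homog_def by blast
  then have "as k = m" by (simp add: deg_0)
  moreover have "k < s" using k assms(2) by (auto simp: free_module_def)
  ultimately show thesis using that by blast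
qed

text \<open>
  Compose a graded chain map to the other resolution with a chain map back. The composition is
  homotopic to the identity, hence, both differentials being minimal, congruent to it modulo the
  irrelevant ideal. So each basis vector of the first resolution has a unit entry after the round trip, and its degree occurs in the second resolution.
\<close>
lemma minimal_resolution_degrees_subset:
  fixes I :: "('n::finite, 'k::field) mpoly set"
  assumes a: "minimal_graded_free_resolution I a \<epsilon> \<delta>" and b: "minimal_graded_free_resolution I b \<epsilon>' \<delta>'"
  shows "set (b 0) \<subseteq> set (a 0)" and "set (b 1) \<subseteq> set (a 1)"
proof -
  note aD = minimal_graded_free_resolutionD[OF a] and bD = minimal_graded_free_resolutionD[OF b]
  note ra = is_resolutionD[OF aD(1)] and rb = is_resolutionD[OF bD(1)]
  let ?E = "\<lambda>x. single (0::nat) (\<epsilon> x)" and ?E' = "\<lambda>x. single (0::nat) (\<epsilon>' x)"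
  let ?P = "\<lambda>i. free_module (length (a i))" and ?Q = "\<lambda>i. free_module (length (b i))"
  have "?E' (basis_vec k) \<in> ?E ` ?P 0" if "k < length (b 0)" for k
    unfolding ra(3) rb(3)[symmetric] using that by simp
  note lift0 = total.homog_lift[OF rb(1) ra(1) this bD(2) aD(2)]
  obtain \<phi> where \<phi>: "linear_map \<phi>" "\<And>x. \<phi> x \<in> ?P 0" "\<And>x. x \<in> ?Q 0 \<Longrightarrow> ?E (\<phi> x) = ?E' x"
    and \<phi>hom: "\<And>k. k < length (b 0) \<Longrightarrow> total.homog (\<lambda>l. a 0 ! l) (b 0 ! k) (\<phi> (basis_vec k))"
    by (rule lift0) blast+
  have \<delta>'b: "\<delta>' 0 x \<in> ?Q 0 \<and> ?E' (\<delta>' 0 x) = 0" if "x \<in> ?Q 1" for x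
    using rb(4) that by blast
  have t1: "\<phi> (\<delta>' 0 (basis_vec k)) \<in> \<delta> 0 ` ?P 1" if "k < length (b 1)" for k
  proof -
    have b: "\<delta>' 0 (basis_vec k) \<in> ?Q 0" "?E' (\<delta>' 0 (basis_vec k)) = 0"
      using \<delta>'b[of "basis_vec k"] that by simp_all
    then show ?thesis unfolding ra(4) using \<phi>(2) \<phi>(3)[OF b(1)] by simp
  qed
  have t2: "total.homog (\<lambda>l. a 0 ! l) (b 1 ! k) (\<phi> (\<delta>' 0 (basis_vec k)))" if "k < length (b 1)" for k
  proof (rule total.homog_linear_map[OF \<phi>(1) \<phi>hom])
    show "\<delta>' 0 (basis_vec k) \<in> ?Q 0" using \<delta>'b[of "basis_vec k"] that by simp
    show "total.homog (\<lambda>l. b 0 ! l) (b 1 ! k) (\<delta>' 0 (basis_vec k))"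
      using bD(3)[of k 0] that by simp
  qed
  have t3: "total.homog (\<lambda>l. a 0 ! l) (a 1 ! k) (\<delta> 0 (basis_vec k))" if "k < length (a 1)" for k
    using aD(3)[of k 0] that by simp
  obtain t where t: "linear_map t" "\<And>x. t x \<in> ?P 1"
      "\<And>x. x \<in> ?Q 1 \<Longrightarrow> \<delta> 0 (t x) = \<phi> (\<delta>' 0 x)"
    and thom: "\<And>k. k < length (b 1) \<Longrightarrow> total.homog (\<lambda>l. a 1 ! l) (b 1 ! k) (t (basis_vec k))"
    by (rule total.homog_lift[OF linear_map_compose[OF \<phi>(1) rb(2)] ra(2) t1 t2 t3]) auto
  obtain \<psi> g H where \<psi>: "linear_map \<psi>" "\<And>x. \<psi> x \<in> ?Q 0" and g: "linear_map g" "\<And>x. g x \<in> ?Q 1"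
    and H: "linear_map H" "\<And>x. H x \<in> ?Q 1"
    and h0: "\<And>x. x \<in> ?Q 0 \<Longrightarrow> ?E' (x - \<psi> (\<phi> x)) = 0"
    and h1: "\<And>x. x \<in> ?Q 1 \<Longrightarrow> \<delta>' 0 (x - H (\<delta>' 0 x) - g (t x)) = 0"
    by (rule homotopy[OF projective_free_module projective_free_module projective_free_module
        projective_free_module ra(1,2) rb(1,2) \<phi>(1) t(1) ra(3,4) rb(3,4) \<phi>(2,3) t(2,3)]) auto
  show "set (b 0) \<subseteq> set (a 0)"
  proof
    fix j assume "j \<in> set (b 0)"
    then obtain k where k: "k < length (b 0)" "j = b 0 ! k" by (auto simp: in_set_conv_nth)
    let ?x = "basis_vec k :: nat \<Rightarrow>\<^sub>0 ('n, 'k) mpoly"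
    have "?x - \<psi> (\<phi> ?x) \<in> \<delta>' 0 ` ?Q 1"
      unfolding rb(4) using h0[of ?x] k(1) smult.subspace_diff[OF subspace_free_module _ \<psi>(2)]
      by simp
    then have "order_at_least 1 (?x - \<psi> (\<phi> ?x))" using bD(4)[of _ 0] by auto
    then have "lookup (lookup (\<psi> (\<phi> ?x)) k) 0 \<noteq> 0"
      unfolding order_at_least_1_iff by (auto simp: lookup_minus lookup_basis_vec dest: spec[of _ k])
    then obtain l where "l < length (a 0)" "a 0 ! l = j"
      using total.degree_from_unit_entry[OF \<psi>(1) \<phi>(2) \<phi>hom[OF k(1)]] k(2) by blast
    then show "j \<in> set (a 0)" by auto
  qed
  show "set (b 1) \<subseteq> set (a 1)"
  proof
    fix j assume "j \<in> set (b 1)"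
    then obtain k where k: "k < length (b 1)" "j = b 1 ! k" by (auto simp: in_set_conv_nth)
    let ?x = "basis_vec k :: nat \<Rightarrow>\<^sub>0 ('n, 'k) mpoly"
    have "?x - H (\<delta>' 0 ?x) - g (t ?x) \<in> {x \<in> ?Q (Suc 0). \<delta>' 0 x = 0}"
      using h1[of ?x] k(1) smult.subspace_diff[OF subspace_free_module _ g(2)]
        smult.subspace_diff[OF subspace_free_module _ H(2)] by simp
    then have "?x - H (\<delta>' 0 ?x) - g (t ?x) \<in> \<delta>' (Suc 0) ` ?Q (Suc (Suc 0))" unfolding rb(5) .
    then have 1: "order_at_least 1 (?x - H (\<delta>' 0 ?x) - g (t ?x))" using bD(4) by auto
    have "order_at_least 1 (\<delta>' 0 ?x)" using bD(4)[of ?x 0] k by simp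
    then have "order_at_least (1 + 0) (H (\<delta>' 0 ?x))"
      by (rule order_at_least_linear_map[OF H(1)]) simp
    with 1 have "lookup (lookup (g (t ?x)) k) 0 \<noteq> 0"
      unfolding order_at_least_1_iff add_0_right
      by (auto simp: lookup_minus lookup_basis_vec dest: spec[of _ k])
    then obtain l where "l < length (a 1)" "a 1 ! l = j"
      using total.degree_from_unit_entry[OF g(1) t(2) thom[OF k(1)]] k(2) by blast
    then show "j \<in> set (a 1)" by auto
  qed
qed

section \<open>Minimal monomial generators\<close>

lemma keys_monomial [simp]: "keys (monomial u :: ('n, 'k::comm_ring_1) mpoly) = {u}"
  by (simp add: monomial_def)

text \<open>
  The exponents in the ideal that are minimal under divisibility form a generating set that is
  contained in every other one; minimal elements exist below each exponent because proper divisors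
  have smaller degree.
\<close>
lemma min_gens_generates:
  fixes I :: "('n::finite, 'k::comm_ring_1) mpoly set"
  assumes "monomial_ideal I"
  shows "minimal_monomial_generating_set (min_gens I) I"
proof -
  obtain U where U: "I = ideal_of (monomial ` U)"
    using assms unfolding monomial_ideal_def by blast
  define W where "W = {w. (monomial w :: ('n, 'k) mpoly) \<in> I}"
  define M where "M = {w \<in> W. \<forall>w'\<in>W. w' \<preceq> w \<longrightarrow> w' = w}"
  have W_iff: "w \<in> W \<longleftrightarrow> (\<exists>v\<in>V. v \<preceq> w)" if "I = ideal_of (monomial ` V)" for V w
    unfolding W_def that by (simp add: ideal_of_monomials_iff)
  have below: "\<exists>m\<in>M. m \<preceq> w" if w: "w \<in> W" for w
  proof -
    obtain m where m: "m \<in> W \<and> m \<preceq> w"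
      and least: "\<And>m'. m' \<in> W \<and> m' \<preceq> w \<Longrightarrow> expo_deg m \<le> expo_deg m'"
      using ex_has_least_nat[of "\<lambda>m. m \<in> W \<and> m \<preceq> w" w expo_deg] w expo_dvd_refl by blast
    have "w' = m" if "w' \<in> W" "w' \<preceq> m" for w'
      using that m least[of w'] expo_dvd_trans expo_dvd_same_deg expo_dvd_deg_le le_antisym by metis
    then show ?thesis using m unfolding M_def by blast
  qed
  have up: "w \<in> W" if "m \<in> W" "m \<preceq> w" for m w
    using that W_iff[OF U] expo_dvd_trans by blast
  have genM: "ideal_of (monomial ` M) = I"
  proof -
    have "(\<exists>m\<in>M. m \<preceq> w) \<longleftrightarrow> (\<exists>u\<in>U. u \<preceq> w)" for w
      using below up W_iff[OF U, of w] unfolding M_def by blast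
    then show ?thesis
      unfolding U by (intro set_eqI) (simp add: ideal_of_monomials_iff)
  qed
  have M_sub: "M \<subseteq> V" if V: "I = ideal_of (monomial ` V)" for V
  proof
    fix m assume m: "m \<in> M"
    then obtain v where v: "v \<in> V" "v \<preceq> m" using W_iff[OF V] unfolding M_def by blast
    then have "v \<in> W" using W_iff[OF V] expo_dvd_refl by blast
    then show "m \<in> V" using m v unfolding M_def by blast
  qed
  have "minimal_monomial_generating_set M I"
    unfolding minimal_monomial_generating_set_def using genM M_sub by blast
  moreover have "V = M" if "minimal_monomial_generating_set V I" for V
    using that genM M_sub[of V] unfolding minimal_monomial_generating_set_def by blast
  ultimately show ?thesis unfolding min_gens_def by (rule theI)
qed

section \<open>Taylor syzygies\<close>

text \<open>
  Subtraction of exponents truncates at zero, so this is the pointwise maximum; the summand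
  \<open>v - u\<close> is the exponent of \<open>lcm(u, v) / u\<close>.
\<close>
definition expo_lcm :: "'n expo \<Rightarrow> 'n expo \<Rightarrow> 'n expo" where
  "expo_lcm u v = (v - u) + u"

lemma lookup_expo_lcm: "lookup (expo_lcm u v) i = max (lookup u i) (lookup v i)"
  by (simp add: expo_lcm_def lookup_add lookup_minus)

lemma expo_lcm_commute: "expo_lcm u v = expo_lcm v u"
  by (rule poly_mapping_eqI) (simp add: lookup_expo_lcm max.commute)

lemma expo_lcm_dvd_iff: "expo_lcm u v \<preceq> w \<longleftrightarrow> u \<preceq> w \<and> v \<preceq> w"
  by (auto simp: expo_dvd_def lookup_expo_lcm)

lemma dvd_expo_lcm: "u \<preceq> expo_lcm u v" "v \<preceq> expo_lcm u v"
  by (simp_all add: expo_dvd_def lookup_expo_lcm)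

text \<open>
  The generators are listed so that their positions can index the basis of the free module mapping
  onto the ideal.
\<close>
locale equigenerated =
  fixes us :: "('n::finite) expo list" and d :: nat
  assumes distinct_us: "distinct us" and deg_us: "u \<in> set us \<Longrightarrow> expo_deg u = d"
begin

text \<open>
  The Taylor syzygy of the generators at positions \<open>p\<close> and \<open>q\<close>.
\<close>
definition syz :: "nat \<Rightarrow> nat \<Rightarrow> (nat \<Rightarrow>\<^sub>0 ('n, 'k::comm_ring_1) mpoly)" where
  "syz p q = single p (monomial (us ! q - us ! p)) - single q (monomial (us ! p - us ! q))"

definition lcm_at :: "nat \<Rightarrow> nat \<Rightarrow> 'n expo" where
  "lcm_at p q = expo_lcm (us ! p) (us ! q)"

definition augmentation :: "(nat \<Rightarrow>\<^sub>0 ('n, 'k::comm_ring_1) mpoly) \<Rightarrow> (nat \<Rightarrow>\<^sub>0 ('n, 'k) mpoly)" where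
  "augmentation = linear_extension (\<lambda>k. single 0 (monomial (us ! k)))"

definition syzygies :: "(nat \<Rightarrow>\<^sub>0 ('n, 'k::comm_ring_1) mpoly) set" where
  "syzygies = {x \<in> free_module (length us). augmentation x = 0}"

lemma linear_map_augmentation: "linear_map augmentation"
  unfolding augmentation_def by (rule linear_map_extension)

lemma augmentation_single: "augmentation (single k f) = single 0 (f * monomial (us ! k))"
  unfolding single_eq_smult_basis_vec[of k f] linear_map_scale[OF linear_map_augmentation]
  by (simp add: augmentation_def smult_single)

lemma augmentation_expansion:
  "augmentation x = single 0 (\<Sum>k\<in>keys x. lookup x k * monomial (us ! k))"
  by (simp add: augmentation_def linear_extension_def smult_single single_sum)

lemma subspace_syzygies: "smult.subspace syzygies"
  unfolding syzygies_def
  using smult.subspace_inter[OF subspace_free_module module_hom.subspace_kernel[OF linear_map_augmentation]]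
  by (simp add: Int_def)

lemma syz_refl [simp]: "syz p p = 0"
  by (simp add: syz_def)

lemma syz_commute: "syz q p = - syz p q"
  by (simp add: syz_def)

lemma augmentation_syz: "augmentation (syz p q) = 0"
  using expo_lcm_commute[of "us ! p" "us ! q"]
  by (simp add: syz_def linear_map_diff[OF linear_map_augmentation] augmentation_single
      monomial_def mult_single expo_lcm_def)

lemma keys_syz: "keys (syz p q) \<subseteq> {p, q}"
  by (auto simp: syz_def in_keys_iff lookup_minus lookup_single when_def split: if_splits)

lemma index_syz:
  assumes "v \<in> keys (lookup (syz p q :: nat \<Rightarrow>\<^sub>0 ('n, 'k::comm_ring_1) mpoly) k)"
    and "p < length us" and "q < length us"
  shows "k < length us"
proof -
  have "k \<in> keys (syz p q :: nat \<Rightarrow>\<^sub>0 ('n, 'k) mpoly)"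
    using assms(1) by (auto simp: in_keys_iff)
  then show ?thesis using keys_syz assms(2,3) by blast
qed

lemma syz_in_syzygies: "p < length us \<Longrightarrow> q < length us \<Longrightarrow> syz p q \<in> syzygies"
  using keys_syz[of p q] by (auto simp: syzygies_def free_module_def augmentation_syz)

text \<open>
  Multiples of a Taylor syzygy take a telescoping form once they are brought to a common multidegree.
\<close>
lemma smult_monomial_syz:
  assumes "lcm_at p q \<preceq> w"
  shows "smult (single (w - lcm_at p q) c) (syz p q) =
    single p (single (w - us ! p) c) - single q (single (w - us ! q) c)"
proof -
  have "(w - lcm_at p q) + (us ! q - us ! p) = w - us ! p"
    and "(w - lcm_at p q) + (us ! p - us ! q) = w - us ! q"
    using assms by (auto intro!: poly_mapping_eqI
        simp: lcm_at_def expo_dvd_def lookup_expo_lcm lookup_add lookup_minus)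
  then show ?thesis
    by (simp add: syz_def smult.scale_right_diff_distrib smult_single monomial_def mult_single)
qed

lemma keys_lookup_syz:
  assumes v: "v \<in> keys (lookup (syz p q :: nat \<Rightarrow>\<^sub>0 ('n, 'k::comm_ring_1) mpoly) k)"
  shows "v + us ! k = lcm_at p q"
proof -
  have "p \<noteq> q" using v by auto
  then have "k = p \<and> v = us ! q - us ! p \<or> k = q \<and> v = us ! p - us ! q"
    using v by (cases "k = p"; cases "k = q")
      (auto simp: syz_def lookup_minus lookup_single monomial_def split: if_splits)
  then show ?thesis
    using expo_lcm_commute[of "us ! p" "us ! q"] by (auto simp: lcm_at_def expo_lcm_def)
qed

lemma homog_syz: "multi.homog ((!) us) (lcm_at p q) (syz p q)"
  unfolding multi.homog_def by (intro allI ballI) (rule keys_lookup_syz)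

lemma expo_deg_us_nth [simp]: "p < length us \<Longrightarrow> expo_deg (us ! p) = d"
  by (simp add: deg_us)

lemma total_homog_syz:
  assumes "p < length us" and "q < length us"
  shows "total.homog (\<lambda>k. replicate (length us) d ! k) (expo_deg (lcm_at p q))
    (syz p q :: nat \<Rightarrow>\<^sub>0 ('n, 'k::comm_ring_1) mpoly)"
  unfolding total.homog_def
proof (intro allI ballI)
  fix k v assume v: "v \<in> keys (lookup (syz p q :: nat \<Rightarrow>\<^sub>0 ('n, 'k) mpoly) k)"
  then have "k < length us"
    using assms by (rule index_syz)
  moreover have "v + us ! k = lcm_at p q" using v by (rule keys_lookup_syz)
  ultimately show "expo_deg v + replicate (length us) d ! k = expo_deg (lcm_at p q)"
    using expo_deg_add[of v "us ! k"] by simp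
qed

lemma deg_lcm_at:
  assumes "p < length us" and "q < length us" and "p \<noteq> q"
  shows "d < expo_deg (lcm_at p q)"
proof (rule ccontr)
  assume "\<not> ?thesis"
  then have "expo_deg (lcm_at p q) \<le> d" by simp
  moreover have "us ! p \<preceq> lcm_at p q" "us ! q \<preceq> lcm_at p q"
    unfolding lcm_at_def by (rule dvd_expo_lcm)+
  ultimately have "us ! p = lcm_at p q" "us ! q = lcm_at p q"
    using assms expo_dvd_deg_le expo_dvd_same_deg by (metis expo_deg_us_nth le_antisym)+
  then show False using distinct_us assms by (simp add: nth_eq_iff_index_eq[symmetric])
qed

lemma order_at_least_syz:
  assumes "p < length us" and "q < length us"
  shows "order_at_least 1 (syz p q :: nat \<Rightarrow>\<^sub>0 ('n, 'k::comm_ring_1) mpoly)"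
  unfolding order_at_least_def
proof (intro allI ballI)
  fix k v assume v: "v \<in> keys (lookup (syz p q :: nat \<Rightarrow>\<^sub>0 ('n, 'k) mpoly) k)"
  then have "p \<noteq> q" by auto
  have "k < length us"
    using v assms by (rule index_syz)
  moreover have "v + us ! k = lcm_at p q" using v by (rule keys_lookup_syz)
  ultimately show "1 \<le> expo_deg v"
    using deg_lcm_at[OF assms \<open>p \<noteq> q\<close>] expo_deg_add[of v "us ! k"] by simp
qed

text \<open>
  A term of a syzygy cannot cancel alone in its multidegree, so a second position carries a term of
  the same multidegree. Subtracting a multiple of the Taylor syzygy of the two positions removes
  the first term and changes only the coefficient of the second; induct on the number of terms.
\<close>
lemma syzygies_spanned:
  "(syzygies :: (nat \<Rightarrow>\<^sub>0 ('n, 'k::comm_ring_1) mpoly) set) \<subseteq>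
     smult.span {syz p q | p q. p < length us \<and> q < length us}" (is "_ \<subseteq> ?S")
proof
  fix x :: "nat \<Rightarrow>\<^sub>0 ('n, 'k) mpoly"
  define terms where "terms = (\<lambda>x :: nat \<Rightarrow>\<^sub>0 ('n, 'k) mpoly. SIGMA k:keys x. keys (lookup x k))"
  have in_terms: "(k, v) \<in> terms x \<longleftrightarrow> lookup (lookup x k) v \<noteq> 0" for k v x
    by (auto simp: terms_def in_keys_iff)
  have fin: "finite (terms x)" for x by (simp add: terms_def)
  assume "x \<in> syzygies"
  then show "x \<in> ?S"
  proof (induction "card (terms x)" arbitrary: x rule: less_induct)
    case less
    show ?case
    proof (cases "terms x = {}")
      case True
      then have "x = 0" by (intro multi.vector_eqI) (use in_terms in force)
      then show ?thesis by (simp add: smult.span_zero)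
    next
      case False
      then obtain k v where kv: "(k, v) \<in> terms x" by auto
      define c where "c = lookup (lookup x k) v"
      define w where "w = v + us ! k"
      have x: "x \<in> free_module (length us)" "augmentation x = 0"
        using less.prems by (auto simp: syzygies_def)
      have c: "c \<noteq> 0" using kv by (simp add: in_terms c_def)
      have k: "k \<in> keys x" using kv by (auto simp: terms_def)
      have "(\<Sum>l\<in>keys x. lookup (lookup x l * monomial (us ! l)) w) = 0"
        using x(2) by (simp add: augmentation_expansion lookup_sum[symmetric])
      then have "c + (\<Sum>l\<in>keys x - {k}. lookup (lookup x l * monomial (us ! l)) w) = 0"
        using sum.remove[OF finite_keys k, of "\<lambda>l. lookup (lookup x l * monomial (us ! l)) w"]
        by (simp add: w_def c_def lookup_mult_monomial)
      then obtain l where l: "l \<in> keys x" "l \<noteq> k" "lookup (lookup x l * monomial (us ! l)) w \<noteq> 0"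
        using c by (metis (no_types, lifting) Diff_iff add.right_neutral insertI1 sum.neutral)
      then have "w \<in> keys (lookup x l * monomial (us ! l))" by (simp add: in_keys_iff)
      then obtain v' where v': "v' \<in> keys (lookup x l)" "w = v' + us ! l"
        by (rule in_keys_mult_monomial)
      have kl: "k < length us" "l < length us" using x(1) k l(1) by (auto simp: free_module_def)
      let ?s = "smult (single (w - lcm_at k l) c) (syz k l)"
      have "lcm_at k l \<preceq> w"
        unfolding lcm_at_def expo_lcm_dvd_iff using expo_dvd_add v'(2) w_def by metis
      then have s: "?s = single k (single (w - us ! k) c) - single l (single (w - us ! l) c)"
        by (rule smult_monomial_syz)
      have "w - us ! k = v" by (simp add: w_def)
      moreover have "w - us ! l = v'" by (simp add: v'(2))
      ultimately have s': "?s = single k (single v c) - single l (single v' c)" using s by simp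
      let ?y = "x - ?s"
      have sS: "?s \<in> ?S" using kl by (intro smult.span_scale smult.span_base) blast
      have y: "?y \<in> syzygies"
        by (intro smult.subspace_diff[OF subspace_syzygies] less.prems
            smult.subspace_scale[OF subspace_syzygies] syz_in_syzygies kl)
      have "terms ?y \<subseteq> terms x - {(k, v)}"
      proof (rule subrelI)
        fix k1 v1 assume a: "(k1, v1) \<in> terms ?y"
        have "(k1, v1) \<noteq> (k, v)"
          using a l(2) unfolding in_terms s'
          by (auto simp: lookup_minus lookup_single c_def)
        moreover have "(k1, v1) \<in> terms x"
        proof (cases "(k1, v1) = (l, v')")
          case True
          then show ?thesis using v'(1) by (auto simp: in_terms in_keys_iff)
        next
          case False
          then show ?thesis using a calculation unfolding in_terms s'
            by (auto simp: lookup_minus lookup_single when_def split: if_splits)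
        qed
        ultimately show "(k1, v1) \<in> terms x - {(k, v)}" by blast
      qed
      then have "card (terms ?y) < card (terms x)"
        using kv by (intro psubset_card_mono fin) blast
      then have "?y \<in> ?S" using less.hyps y by blast
      then have "?y + ?s \<in> ?S" using sS by (rule smult.span_add)
      then show ?thesis by simp
    qed
  qed
qed

abbreviation index_pairs :: "(nat \<times> nat) set" where
  "index_pairs \<equiv> {..<length us} \<times> {..<length us}"

abbreviation syz_pair :: "nat \<times> nat \<Rightarrow> (nat \<Rightarrow>\<^sub>0 ('n, 'k::comm_ring_1) mpoly)" where
  "syz_pair b \<equiv> syz (fst b) (snd b)"

abbreviation lcm_pair :: "nat \<times> nat \<Rightarrow> 'n expo" where
  "lcm_pair b \<equiv> lcm_at (fst b) (snd b)"

definition syz_map :: "(nat \<times> nat) list \<Rightarrow> (nat \<Rightarrow>\<^sub>0 ('n, 'k::comm_ring_1) mpoly) \<Rightarrow>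
    (nat \<Rightarrow>\<^sub>0 ('n, 'k) mpoly)" where
  "syz_map ps = linear_extension (\<lambda>k. if k < length ps then syz_pair (ps ! k) else 0)"

lemma linear_map_syz_map: "linear_map (syz_map ps)"
  unfolding syz_map_def by (rule linear_map_extension)

lemma syz_map_basis_vec [simp]: "k < length ps \<Longrightarrow> syz_map ps (basis_vec k) = syz_pair (ps ! k)"
  by (simp add: syz_map_def)

lemma syz_map_image:
  "(syz_map ps ` free_module (length ps) :: (nat \<Rightarrow>\<^sub>0 ('n, 'k::comm_ring_1) mpoly) set) =
    smult.span (syz_pair ` set ps)"
proof -
  have "syz_map ps ` basis_vec ` {..<length ps} = (syz_pair ` set ps :: (nat \<Rightarrow>\<^sub>0 ('n, 'k) mpoly) set)"
    by (auto simp: image_image set_conv_nth image_iff intro!: exI)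
  then show ?thesis by (simp add: image_free_module_eq_span[OF linear_map_syz_map])
qed

lemma syz_pair_span_subset_syzygies:
  assumes "T \<subseteq> index_pairs"
  shows "smult.span (syz_pair ` T) \<subseteq> syzygies"
  using assms by (intro smult.span_minimal subspace_syzygies) (auto intro!: syz_in_syzygies)

text \<open>
  Take a generating subset of least cardinality. The result is a list because its positions index
  the basis of the next free module.
\<close>
lemma irredundant_relations:
  fixes T :: "(nat \<times> nat) set"
  assumes T: "T \<subseteq> index_pairs"
    and span: "(syzygies :: (nat \<Rightarrow>\<^sub>0 ('n, 'k::comm_ring_1) mpoly) set) \<subseteq> smult.span (syz_pair ` T)"
  shows "\<exists>ps. distinct ps \<and> set ps \<subseteq> T \<and>
    smult.span (syz_pair ` set ps) = (syzygies :: (nat \<Rightarrow>\<^sub>0 ('n, 'k) mpoly) set) \<and>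
    (\<forall>b\<in>set ps. (syz_pair b :: nat \<Rightarrow>\<^sub>0 ('n, 'k) mpoly) \<notin> smult.span (syz_pair ` (set ps - {b})))"
proof -
  let ?gen = "\<lambda>B. B \<subseteq> T \<and> smult.span (syz_pair ` B) = (syzygies :: (nat \<Rightarrow>\<^sub>0 ('n, 'k) mpoly) set)"
  have "?gen T" using syz_pair_span_subset_syzygies[OF T] span by blast
  then obtain B where B: "?gen B" and least: "\<And>B'. ?gen B' \<Longrightarrow> card B \<le> card B'"
    using ex_has_least_nat[of ?gen T card] by blast
  have "finite B" using B T finite_subset[of _ index_pairs] by blast
  then obtain ps where ps: "set ps = B" "distinct ps" using finite_distinct_list by blast
  have "(syz_pair b :: nat \<Rightarrow>\<^sub>0 ('n, 'k) mpoly) \<notin> smult.span (syz_pair ` (B - {b}))" if b: "b \<in> B" for b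
  proof
    assume a: "(syz_pair b :: nat \<Rightarrow>\<^sub>0 ('n, 'k) mpoly) \<in> smult.span (syz_pair ` (B - {b}))"
    have "(syz_pair ` B :: (nat \<Rightarrow>\<^sub>0 ('n, 'k) mpoly) set) \<subseteq> smult.span (syz_pair ` (B - {b}))"
    proof
      fix y :: "nat \<Rightarrow>\<^sub>0 ('n, 'k) mpoly" assume "y \<in> syz_pair ` B"
      then show "y \<in> smult.span (syz_pair ` (B - {b}))"
        using a by (cases "y = syz_pair b") (auto intro!: smult.span_base)
    qed
    then have "smult.span (syz_pair ` B) \<subseteq>
        smult.span (smult.span (syz_pair ` (B - {b})) :: (nat \<Rightarrow>\<^sub>0 ('n, 'k) mpoly) set)"
      by (rule smult.span_mono)
    moreover have "smult.span (syz_pair ` (B - {b})) \<subseteq>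
        (smult.span (syz_pair ` B) :: (nat \<Rightarrow>\<^sub>0 ('n, 'k) mpoly) set)"
      by (intro smult.span_mono) blast
    ultimately have "?gen (B - {b})" using B unfolding smult.span_span by blast
    then show False using least[of "B - {b}"] \<open>finite B\<close> b by (metis card_Diff1_less leD)
  qed
  then show ?thesis using B ps by (intro exI[of _ ps]) simp
qed

lemma homog_syz_map:
  "k < length ps \<Longrightarrow> multi.homog ((!) us) (lcm_pair (ps ! k)) (syz_map ps (basis_vec k))"
  by (simp add: homog_syz)

text \<open>
  A constant term in a relation among the \<open>\<tau>\<^sub>b\<close> could be isolated by passing to the multidegree of
  that \<open>b\<close>, and dividing by the constant would express \<open>\<tau>\<^sub>b\<close> through the other generators.
\<close>
lemma irredundant_kernel:
  fixes x :: "nat \<Rightarrow>\<^sub>0 ('n, 'k::field) mpoly"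
  assumes ps: "distinct ps"
    and irr: "\<forall>b\<in>set ps.
      (syz_pair b :: nat \<Rightarrow>\<^sub>0 ('n, 'k) mpoly) \<notin> smult.span (syz_pair ` (set ps - {b}))"
    and x: "x \<in> free_module (length ps)" "syz_map ps x = 0"
  shows "order_at_least 1 x"
proof (rule ccontr)
  assume "\<not> ?thesis"
  then obtain k where k: "lookup (lookup x k) 0 \<noteq> 0" unfolding order_at_least_1_iff by blast
  define c where "c = lookup (lookup x k) 0"
  have c: "c \<noteq> 0" using k by (simp add: c_def)
  have "k \<in> keys x" using k by (auto simp: in_keys_iff)
  then have klen: "k < length ps" using x(1) by (auto simp: free_module_def)
  define y where "y = multi.part (\<lambda>l. lcm_pair (ps ! l)) (lcm_pair (ps ! k)) x"
  have y_free: "y \<in> free_module (length ps)"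
    unfolding y_def by (rule multi.part_in_free_module[OF x(1)])
  have "syz_map ps y = multi.part ((!) us) (lcm_pair (ps ! k)) (syz_map ps x)"
    unfolding y_def by (rule multi.part_linear_map[OF linear_map_syz_map homog_syz_map x(1)])
  then have "syz_map ps y = 0" by (simp add: x(2))
  moreover have yk: "lookup y k = single 0 c"
    by (rule poly_mapping_eqI) (simp add: y_def multi.lookup_part lookup_single c_def when_def)
  moreover have kk: "k \<in> keys y" using yk c by (simp add: in_keys_iff)
  ultimately have "0 = smult (single 0 c) (syz_pair (ps ! k)) +
      (\<Sum>l\<in>keys y - {k}. smult (lookup y l) (syz_map ps (basis_vec l)))"
    using linear_map_expansion[OF linear_map_syz_map, of ps y] klen
    by (simp add: sum.remove[OF finite_keys kk])
  then have "smult (single 0 c) (syz_pair (ps ! k)) =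
      - (\<Sum>l\<in>keys y - {k}. smult (lookup y l) (syz_map ps (basis_vec l)))"
    by (simp add: eq_neg_iff_add_eq_0)
  also have "\<dots> \<in> smult.span (syz_pair ` (set ps - {ps ! k}))"
  proof (intro smult.span_neg smult.span_sum smult.span_scale)
    fix l assume l: "l \<in> keys y - {k}"
    then have "l < length ps" using y_free by (auto simp: free_module_def)
    moreover have "ps ! l \<noteq> ps ! k" using l klen \<open>l < length ps\<close> ps by (simp add: nth_eq_iff_index_eq)
    ultimately show "syz_map ps (basis_vec l) \<in> smult.span (syz_pair ` (set ps - {ps ! k}))"
      by (auto intro!: smult.span_base)
  qed
  finally have "smult (single 0 (inverse c)) (smult (single 0 c) (syz_pair (ps ! k)))
      \<in> smult.span (syz_pair ` (set ps - {ps ! k}))"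
    by (rule smult.span_scale)
  then have "syz_pair (ps ! k) \<in> smult.span (syz_pair ` (set ps - {ps ! k}) :: (nat \<Rightarrow>\<^sub>0 ('n, 'k) mpoly) set)"
    using c by (simp add: mult_single)
  then show False using irr klen by simp
qed

lemma augmentation_image:
  fixes I :: "('n, 'k::comm_ring_1) mpoly set"
  assumes "I = ideal_of (monomial ` set us)"
  shows "augmentation ` free_module (length us) = single 0 ` I"
proof -
  interpret M: module "(*) :: ('n, 'k) mpoly \<Rightarrow> _" by (rule module_mult)
  have hom: "module_hom (*) smult (single 0 :: ('n, 'k) mpoly \<Rightarrow> (nat \<Rightarrow>\<^sub>0 ('n, 'k) mpoly))"
    by (simp add: module_hom_iff module_mult module_smult single_add smult_single)
  have "augmentation ` basis_vec ` {..<length us} =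
      (single 0 ` monomial ` set us :: (nat \<Rightarrow>\<^sub>0 ('n, 'k) mpoly) set)"
    by (auto simp: augmentation_def image_image set_conv_nth image_iff intro!: exI)
  then show ?thesis
    unfolding assms image_free_module_eq_span[OF linear_map_augmentation]
    by (simp add: module_hom.span_image[OF hom])
qed

lemma irredundant_relations_free:
  fixes I :: "('n, 'k::field) mpoly set"
  assumes I: "I = ideal_of (monomial ` set us)" and pd: "has_projective_resolution_of_length I 1"
    and ps: "distinct ps" and span: "smult.span (syz_pair ` set ps) = (syzygies :: (nat \<Rightarrow>\<^sub>0 ('n, 'k) mpoly) set)"
    and irr: "\<forall>b\<in>set ps.
      (syz_pair b :: nat \<Rightarrow>\<^sub>0 ('n, 'k) mpoly) \<notin> smult.span (syz_pair ` (set ps - {b}))"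
  shows "\<forall>x\<in>free_module (length ps). syz_map ps x = (0 :: nat \<Rightarrow>\<^sub>0 ('n, 'k) mpoly) \<longrightarrow> x = 0"
proof (intro ballI impI,
    rule minimal_kernel_zero[OF pd linear_map_augmentation linear_map_syz_map augmentation_image[OF I]])
  show "syz_map ps ` free_module (length ps) =
      {x \<in> free_module (length us). augmentation x = (0 :: nat \<Rightarrow>\<^sub>0 ('n, 'k) mpoly)}"
    by (simp only: syz_map_image span syzygies_def)
  show "order_at_least 1 y" if "y \<in> free_module (length ps)" "syz_map ps y = 0"
    for y :: "nat \<Rightarrow>\<^sub>0 ('n, 'k) mpoly"
    by (rule irredundant_kernel[OF ps irr that])
qed

text \<open>
  The differential is minimal because distinct generators of equal degree do not divide each other,
  so the coefficients of a Taylor syzygy are not units.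
\<close>
lemma taylor_resolution:
  fixes I :: "('n, 'k::field) mpoly set"
  assumes I: "I = ideal_of (monomial ` set us)" and pd: "has_projective_resolution_of_length I 1"
    and ps: "distinct ps" "set ps \<subseteq> index_pairs"
    and span: "smult.span (syz_pair ` set ps) = (syzygies :: (nat \<Rightarrow>\<^sub>0 ('n, 'k) mpoly) set)"
    and irr: "\<forall>b\<in>set ps.
      (syz_pair b :: nat \<Rightarrow>\<^sub>0 ('n, 'k) mpoly) \<notin> smult.span (syz_pair ` (set ps - {b}))"
  shows "\<exists>a \<epsilon> \<delta>. minimal_graded_free_resolution I a \<epsilon> \<delta> \<and>
    a 0 = replicate (length us) d \<and> a 1 = map (\<lambda>b. expo_deg (lcm_pair b)) ps"
proof -
  define a where "a = (\<lambda>i :: nat. if i = 0 then replicate (length us) d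
    else if i = 1 then map (\<lambda>b. expo_deg (lcm_pair b)) ps else [])"
  define \<epsilon> where "\<epsilon> = (\<lambda>x :: nat \<Rightarrow>\<^sub>0 ('n, 'k) mpoly. lookup (augmentation x) 0)"
  define \<delta> where "\<delta> = (\<lambda>i :: nat. if i = 0 then syz_map ps else (\<lambda>x :: nat \<Rightarrow>\<^sub>0 ('n, 'k) mpoly. 0))"
  have a: "a 0 = replicate (length us) d" "a (Suc 0) = map (\<lambda>b. expo_deg (lcm_pair b)) ps"
    "a (Suc (Suc i)) = []" for i
    by (simp_all add: a_def)
  have aug: "augmentation x = single 0 (\<epsilon> x)" for x
    by (simp add: \<epsilon>_def augmentation_expansion)
  have \<epsilon>_hom: "module_hom smult (*) \<epsilon>"
    unfolding \<epsilon>_def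
    by (simp add: module_hom_iff module_mult module_smult linear_map_add[OF linear_map_augmentation]
        linear_map_scale[OF linear_map_augmentation] lookup_add lookup_smult)
  have \<epsilon>_image: "\<epsilon> ` free_module (length us) = I"
  proof -
    have "(\<lambda>x. lookup x 0) ` augmentation ` free_module (length us) = (\<lambda>x. lookup x (0::nat)) ` single 0 ` I"
      by (simp only: augmentation_image[OF I])
    then show ?thesis by (simp add: image_image \<epsilon>_def)
  qed
  have ker: "syz_map ps ` free_module (length ps) = {x \<in> free_module (length us). \<epsilon> x = 0}"
    by (simp add: syz_map_image span syzygies_def aug)
  have inj: "\<forall>x\<in>free_module (length ps). syz_map ps x = (0 :: nat \<Rightarrow>\<^sub>0 ('n, 'k) mpoly) \<longrightarrow> x = 0"
    by (rule irredundant_relations_free[OF I pd ps(1) span irr])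
  have free0: "free_module 0 = {0 :: nat \<Rightarrow>\<^sub>0 ('n, 'k) mpoly}"
    by (auto simp: free_module_def poly_mapping_eq_iff fun_eq_iff in_keys_iff)
  have syz0: "syz_map ps 0 = (0 :: nat \<Rightarrow>\<^sub>0 ('n, 'k) mpoly)"
    by (rule linear_map_zero[OF linear_map_syz_map])
  have lin\<delta>: "linear_map (\<delta> i)" for i
    using linear_map_syz_map by (cases "i = 0") (auto simp: \<delta>_def intro: linear_mapI)
  have zero_in: "(0 :: nat \<Rightarrow>\<^sub>0 ('n, 'k) mpoly) \<in> free_module s" for s
    by (simp add: free_module_def)
  have higher: "\<delta> (Suc i) ` free_module (length (a (Suc (Suc i)))) =
      {x \<in> free_module (length (a (Suc i))). \<delta> i x = 0}" for i
  proof (cases i)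
    case 0
    then show ?thesis using inj syz0 zero_in by (auto simp: \<delta>_def a free0)
  next
    case (Suc j)
    then show ?thesis by (auto simp: \<delta>_def a free0)
  qed
  have res: "is_resolution I (\<lambda>i. free_module (length (a i))) \<epsilon> \<delta>"
    unfolding is_resolution_def
    using \<epsilon>_hom lin\<delta> \<epsilon>_image ker higher by (simp add: \<delta>_def a)
  have hom0: "homogeneous (a 0 ! k) (\<epsilon> (basis_vec k))" if "k < length (a 0)" for k
    using that by (simp add: a \<epsilon>_def augmentation_def homogeneous_def)
  have hom1: "graded_elem (a i) (a (Suc i) ! k) (\<delta> i (basis_vec k))" if k: "k < length (a (Suc i))" for i k
  proof (cases i)
    case 0
    then have klen: "k < length ps" using k by (simp add: a)
    then have "ps ! k \<in> set ps" by simp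
    then have "ps ! k \<in> index_pairs" using ps(2) by blast
    then have b: "fst (ps ! k) < length us" "snd (ps ! k) < length us" by auto
    have "\<delta> i (basis_vec k) = syz_pair (ps ! k)" using 0 klen by (simp add: \<delta>_def)
    moreover have "(syz_pair (ps ! k) :: nat \<Rightarrow>\<^sub>0 ('n, 'k) mpoly) \<in> syzygies"
      by (rule syz_in_syzygies[OF b])
    then have "(syz_pair (ps ! k) :: nat \<Rightarrow>\<^sub>0 ('n, 'k) mpoly) \<in> free_module (length us)"
      by (simp add: syzygies_def)
    moreover have "expo_deg v + d = expo_deg (lcm_pair (ps ! k))"
      if "l < length us" "v \<in> keys (lookup (syz_pair (ps ! k) :: nat \<Rightarrow>\<^sub>0 ('n, 'k) mpoly) l)" for l v
      using total_homog_syz[OF b, unfolded total.homog_def, rule_format, OF that(2)] that(1) by simp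
    ultimately show ?thesis using klen by (simp add: graded_elem_def 0 a)
  next
    case (Suc j)
    then show ?thesis using k by (simp add: a)
  qed
  have min: "lookup (\<delta> i x) k \<in> ideal_of (range var)" if x: "x \<in> free_module (length (a (Suc i)))" for i x k
  proof (cases i)
    case 0
    have "order_at_least (0 + 1) (syz_map ps x)"
    proof (rule order_at_least_linear_map[OF linear_map_syz_map])
      fix l assume "l \<in> keys x"
      then have l: "l < length ps" using x by (auto simp: free_module_def 0 a)
      then have "ps ! l \<in> index_pairs" using ps(2) nth_mem by blast
      then show "order_at_least 1 (syz_map ps (basis_vec l) :: nat \<Rightarrow>\<^sub>0 ('n, 'k) mpoly)"
        unfolding syz_map_basis_vec[OF l] by (intro order_at_least_syz) auto
    qed simp
    then have "lookup (lookup (syz_map ps x) k) 0 = 0"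
      unfolding add_0 order_at_least_1_iff by blast
    then show ?thesis by (simp add: in_irrelevant_ideal_iff 0 \<delta>_def)
  next
    case (Suc j)
    then show ?thesis by (simp add: in_irrelevant_ideal_iff \<delta>_def)
  qed
  have "minimal_graded_free_resolution I a \<epsilon> \<delta>"
    unfolding minimal_graded_free_resolution_def using res hom0 hom1 min by blast
  moreover have "a 0 = replicate (length us) d" "a 1 = map (\<lambda>b. expo_deg (lcm_pair b)) ps"
    by (simp_all add: a)
  ultimately show ?thesis by blast
qed

end

section \<open>From linear quotients to linear relations\<close>

lemma in_colon_monomials_iff:
  fixes g :: "('n, 'k::comm_ring_1) mpoly"
  shows "g \<in> colon (ideal_of (monomial ` A)) (monomial u) \<longleftrightarrow>
    (\<forall>w\<in>keys g. \<exists>v\<in>A. v \<preceq> w + u)"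
proof -
  have "keys (g * monomial u) = (\<lambda>w. w + u) ` keys g"
  proof
    show "keys (g * monomial u) \<subseteq> (\<lambda>w. w + u) ` keys g"
      by (auto elim: in_keys_mult_monomial)
    show "(\<lambda>w. w + u) ` keys g \<subseteq> keys (g * monomial u)"
      by (auto simp: in_keys_iff lookup_mult_monomial)
  qed
  then show ?thesis by (simp add: colon_def ideal_of_monomials_iff)
qed

lemma expo_deg_single [simp]: "expo_deg (single x c) = c"
  by (simp add: expo_deg_def lookup_single when_def)

lemma expo_deg_eq_1D:
  assumes "expo_deg v = 1"
  obtains x where "v = single x 1"
proof -
  have "v \<noteq> 0" using assms by auto
  then obtain x where x: "lookup v x \<noteq> 0" by (auto simp: poly_mapping_eq_iff fun_eq_iff)
  then have "single x 1 \<preceq> v" by (auto simp: expo_dvd_def lookup_single when_def)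
  then have "single x 1 = v" using assms by (intro expo_dvd_same_deg) simp_all
  then show thesis using that by metis
qed

text \<open>
  The first assumption puts \<open>x\<close> into the colon ideal, the second says that \<open>x\<close> divides
  \<open>lcm(u, v) / u\<close> for every generator \<open>v\<close>.
\<close>
lemma colon_eq_variable:
  assumes "\<exists>v\<in>A. v \<preceq> single x 1 + u" and "\<And>v. v \<in> A \<Longrightarrow> lookup u x < lookup v x"
  shows "colon (ideal_of (monomial ` A)) (monomial u) = (ideal_of (var ` {x}) :: ('n, 'k::comm_ring_1) mpoly set)"
proof -
  have "(\<exists>v\<in>A. v \<preceq> w + u) \<longleftrightarrow> 0 < lookup w x" for w
  proof
    assume "\<exists>v\<in>A. v \<preceq> w + u"
    then obtain v where v: "v \<in> A" "v \<preceq> w + u" by blast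
    then have "lookup v x \<le> lookup w x + lookup u x" by (simp add: expo_dvd_def lookup_add)
    then show "0 < lookup w x" using assms(2)[OF v(1)] by linarith
  next
    assume "0 < lookup w x"
    then have "single x 1 + u \<preceq> w + u"
      by (auto simp: expo_dvd_def lookup_add lookup_single when_def)
    then show "\<exists>v\<in>A. v \<preceq> w + u" using assms(1) expo_dvd_trans by blast
  qed
  then show ?thesis
    by (intro set_eqI) (simp add: in_colon_monomials_iff ideal_of_vars_iff del: image_insert image_empty)
qed

context equigenerated
begin

lemma syz_cocycle:
  assumes "us ! p \<preceq> w" and "us ! q \<preceq> w" and "us ! j \<preceq> w"
  shows "smult (single (w - lcm_at p q) c) (syz p q) =
    smult (single (w - lcm_at p j) c) (syz p j) + smult (single (w - lcm_at j q) c) (syz j q)"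
proof -
  have "lcm_at p q \<preceq> w" "lcm_at p j \<preceq> w" "lcm_at j q \<preceq> w"
    unfolding lcm_at_def expo_lcm_dvd_iff using assms by simp_all
  then show ?thesis by (simp add: smult_monomial_syz)
qed

definition linear_pairs :: "(nat \<times> nat) set" where
  "linear_pairs = {b \<in> index_pairs. expo_deg (lcm_pair b) = d + 1}"

lemma index_dvd_lcm_at: "us ! p \<preceq> lcm_at p q" "us ! q \<preceq> lcm_at p q"
  unfolding lcm_at_def by (rule dvd_expo_lcm)+

text \<open>
  For \<open>l < i\<close> the quotient \<open>lcm(u\<^sub>l, u\<^sub>i) / u\<^sub>i\<close> lies in the colon ideal, so it is divisible by one of
  its variables \<open>x\<close>, and \<open>x u\<^sub>i\<close> is a multiple of some \<open>u\<^sub>j\<close> with \<open>j < i\<close>. Hence \<open>\<tau>\<^sub>j\<^sub>i\<close> is linear,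
  and since \<open>u\<^sub>j\<close> divides \<open>lcm(u\<^sub>l, u\<^sub>i)\<close>, the syzygy \<open>\<tau>\<^sub>l\<^sub>i\<close> is a combination of \<open>\<tau>\<^sub>l\<^sub>j\<close> and \<open>\<tau>\<^sub>j\<^sub>i\<close>;
  induct on the larger index.
\<close>
lemma linear_relations_of_quotients:
  assumes quot: "\<forall>i. 1 \<le> i \<and> i < length us \<longrightarrow>
    (\<exists>X. colon (ideal_of (monomial ` set (take i us))) (monomial (us ! i)) =
      (ideal_of (var ` X) :: ('n, 'k::comm_ring_1) mpoly set))"
  shows "(syzygies :: (nat \<Rightarrow>\<^sub>0 ('n, 'k) mpoly) set) \<subseteq> smult.span (syz_pair ` linear_pairs)"
proof -
  let ?S = "smult.span (syz_pair ` linear_pairs) :: (nat \<Rightarrow>\<^sub>0 ('n, 'k) mpoly) set"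
  have less: "\<forall>l<i. syz l i \<in> ?S" if "i < length us" for i
    using that
  proof (induction i rule: less_induct)
    case (less i)
    note IH = less.IH
    show ?case
    proof (intro allI impI)
      fix l assume l: "l < i"
      obtain X where X: "colon (ideal_of (monomial ` set (take i us))) (monomial (us ! i)) =
          (ideal_of (var ` X) :: ('n, 'k) mpoly set)"
        using quot[rule_format, of i] l less.prems by auto
      have in_take: "v \<in> set (take i us) \<longleftrightarrow> (\<exists>j<i. v = us ! j)" for v
        using less.prems by (auto simp: in_set_conv_nth)
      have "(us ! l - us ! i) + us ! i = lcm_at l i"
        using expo_lcm_commute[of "us ! l" "us ! i"] by (simp add: lcm_at_def expo_lcm_def)
      then have "(monomial (us ! l - us ! i) :: ('n, 'k) mpoly) \<in>
          colon (ideal_of (monomial ` set (take i us))) (monomial (us ! i))"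
        unfolding in_colon_monomials_iff using l index_dvd_lcm_at(1)[of l i] in_take by auto
      then obtain x where x: "x \<in> X" "0 < lookup (us ! l - us ! i) x"
        unfolding X ideal_of_vars_iff by auto
      have "(var x :: ('n, 'k) mpoly) \<in> ideal_of (var ` X)"
        unfolding ideal_of_vars_iff using x(1) by (auto simp: var_def intro!: bexI[of _ x])
      then have "\<exists>v\<in>set (take i us). v \<preceq> single x 1 + us ! i"
        unfolding X[symmetric] in_colon_monomials_iff by (simp add: var_def)
      then obtain v where v: "v \<in> set (take i us)" "v \<preceq> single x 1 + us ! i" by blast
      then obtain j where "j < i" "v = us ! j" unfolding in_take by blast
      with v(2) have j: "j < i" "us ! j \<preceq> single x 1 + us ! i" by simp_all
      have jlen: "j < length us" "l < length us" using j(1) l less.prems by simp_all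
      have "lcm_at j i \<preceq> single x 1 + us ! i"
        unfolding lcm_at_def expo_lcm_dvd_iff using j(2) expo_dvd_add by blast
      from expo_dvd_deg_le[OF this] have "expo_deg (lcm_at j i) \<le> d + 1"
        using less.prems by (simp add: expo_deg_add)
      then have "(j, i) \<in> linear_pairs"
        using deg_lcm_at[of j i] jlen less.prems j(1) by (simp add: linear_pairs_def)
      then have ji: "syz j i \<in> ?S" by (intro smult.span_base) force
      have "single x 1 + us ! i \<preceq> lcm_at l i"
        using x(2) by (auto simp: expo_dvd_def lcm_at_def lookup_expo_lcm lookup_add lookup_minus
            lookup_single when_def)
      then have "us ! j \<preceq> lcm_at l i" using j(2) expo_dvd_trans by blast
      then have "smult (single (lcm_at l i - lcm_at l i) 1) (syz l i) =
          smult (single (lcm_at l i - lcm_at l j) 1) (syz l j) +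
          smult (single (lcm_at l i - lcm_at j i) 1) (syz j i :: nat \<Rightarrow>\<^sub>0 ('n, 'k) mpoly)"
        by (intro syz_cocycle index_dvd_lcm_at)
      moreover have "syz l j \<in> ?S"
      proof (cases l j rule: linorder_cases)
        case less
        then show ?thesis using IH j(1) jlen by blast
      next
        case equal
        then show ?thesis by (simp add: smult.span_zero)
      next
        case greater
        then have "- syz j l \<in> ?S" using IH l jlen by (blast intro: smult.span_neg)
        then show ?thesis by (simp add: syz_commute[of j l])
      qed
      ultimately show "syz l i \<in> ?S"
        using ji by (simp add: smult.span_add smult.span_scale)
    qed
  qed
  have "syz p q \<in> ?S" if "p < length us" "q < length us" for p q
  proof (cases p q rule: linorder_cases)
    case greater
    then have "- syz q p \<in> ?S" using less that by (blast intro: smult.span_neg)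
    then show ?thesis by (simp add: syz_commute[of q p])
  qed (use less that in \<open>auto simp: smult.span_zero\<close>)
  then have "smult.span {syz p q | p q. p < length us \<and> q < length us} \<subseteq> ?S"
    by (intro smult.span_minimal) auto
  then show ?thesis using syzygies_spanned by blast
qed

section \<open>From linear relations to linear quotients\<close>

lemma syz_map_avoiding:
  fixes v :: "nat \<Rightarrow>\<^sub>0 ('n, 'k::comm_ring_1) mpoly"
  assumes k: "k < length ps" and v: "v \<in> smult.span (syz_pair ` (set ps - {ps ! k}))"
  obtains z where "syz_map ps z = v" and "lookup z k = 0" and "z \<in> free_module (length ps)"
proof -
  let ?N = "{z \<in> free_module (length ps). lookup z k = (0 :: ('n, 'k) mpoly)}"
  have "smult.subspace {z :: nat \<Rightarrow>\<^sub>0 ('n, 'k) mpoly. lookup z k = 0}"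
    by (rule smult.subspaceI) (simp_all add: lookup_add lookup_smult)
  from smult.subspace_inter[OF subspace_free_module[of "length ps"] this]
  have "smult.subspace (?N :: (nat \<Rightarrow>\<^sub>0 ('n, 'k) mpoly) set)" by (simp add: Int_def)
  then have "smult.subspace (syz_map ps ` ?N :: (nat \<Rightarrow>\<^sub>0 ('n, 'k) mpoly) set)"
    by (rule module_hom.subspace_image[OF linear_map_syz_map])
  moreover have "(syz_pair ` (set ps - {ps ! k}) :: (nat \<Rightarrow>\<^sub>0 ('n, 'k) mpoly) set) \<subseteq> syz_map ps ` ?N"
  proof (rule image_subsetI)
    fix b assume "b \<in> set ps - {ps ! k}"
    then obtain l where l: "l < length ps" "b = ps ! l" "l \<noteq> k" by (auto simp: in_set_conv_nth)
    show "(syz_pair b :: nat \<Rightarrow>\<^sub>0 ('n, 'k) mpoly) \<in> syz_map ps ` ?N"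
      by (rule image_eqI[of _ _ "basis_vec l"]) (use l in \<open>simp_all add: lookup_basis_vec\<close>)
  qed
  ultimately have "(smult.span (syz_pair ` (set ps - {ps ! k})) :: (nat \<Rightarrow>\<^sub>0 ('n, 'k) mpoly) set)
      \<subseteq> syz_map ps ` ?N"
    by (intro smult.span_minimal)
  then show thesis using v that by blast
qed

text \<open>
  Connectedness of the graph of relations. The functional \<open>G\<close> evaluates only the positions in \<open>W\<close>. If
  no relation crossed the boundary of \<open>W\<close>, it would vanish on all generating relations, but it
  does not vanish on the syzygy of \<open>l\<close> and \<open>i\<close>.
\<close>
lemma crossing_relation:
  assumes span: "smult.span (syz_pair ` set ps) = (syzygies :: (nat \<Rightarrow>\<^sub>0 ('n, 'k::comm_ring_1) mpoly) set)"
    and W: "l \<in> W" "l < length us" "i \<notin> W" "i < length us"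
  shows "\<exists>b\<in>set ps. fst b \<in> W \<longleftrightarrow> snd b \<notin> W"
proof (rule ccontr)
  assume no: "\<not> ?thesis"
  define G :: "(nat \<Rightarrow>\<^sub>0 ('n, 'k) mpoly) \<Rightarrow> (nat \<Rightarrow>\<^sub>0 ('n, 'k) mpoly)"
    where "G = linear_extension (\<lambda>k. if k \<in> W then single 0 (monomial (us ! k)) else 0)"
  have linG: "linear_map G" unfolding G_def by (rule linear_map_extension)
  have G_single: "G (single k f) = (if k \<in> W then augmentation (single k f) else 0)" for k f
    unfolding single_eq_smult_basis_vec[of k f] linear_map_scale[OF linG]
      linear_map_scale[OF linear_map_augmentation]
    by (simp add: G_def augmentation_def)
  have "G (syz_pair b) = 0" if "b \<in> set ps" for b
  proof -
    have "fst b \<in> W \<longleftrightarrow> snd b \<in> W" using no that by blast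
    then have "G (syz_pair b) = (if fst b \<in> W then augmentation (syz_pair b) else 0)"
      by (simp add: syz_def linear_map_diff[OF linG] linear_map_diff[OF linear_map_augmentation] G_single)
    then show ?thesis by (simp add: augmentation_syz)
  qed
  then have "smult.span (syz_pair ` set ps) \<subseteq> {x. G x = 0}"
    by (intro smult.span_minimal module_hom.subspace_kernel[OF linG]) auto
  then have "G (syz l i) = 0" unfolding span using syz_in_syzygies[OF W(2,4)] by blast
  moreover have "G (syz l i) = single 0 (monomial (us ! i - us ! l) * monomial (us ! l))"
    using W by (simp add: syz_def linear_map_diff[OF linG] G_single augmentation_single)
  ultimately show False by (simp add: monomial_def mult_single)
qed

text \<open>
  The syzygy \<open>\<tau>\<^sub>l\<^sub>i\<close> has an expression by relations all of whose terms have its own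
  multidegree. By assumption a multiple of \<open>\<tau>\<^sub>l\<^sub>i\<close> has an expression in which the \<open>k\<close>-th relation
  has the coefficient \<open>e \<noteq> 0\<close>. The relations are independent, so the first expression also involves
  the \<open>k\<close>-th relation, and the multidegree of that relation divides \<open>lcm(u\<^sub>l, u\<^sub>i)\<close>.
\<close>
lemma lcm_dvd_of_crossing:
  fixes e :: "('n, 'k::comm_ring_1) mpoly"
  assumes span: "smult.span (syz_pair ` set ps) = (syzygies :: (nat \<Rightarrow>\<^sub>0 ('n, 'k) mpoly) set)"
    and inj: "\<forall>x\<in>free_module (length ps). syz_map ps x = (0 :: nat \<Rightarrow>\<^sub>0 ('n, 'k) mpoly) \<longrightarrow> x = 0"
    and li: "l < length us" "i < length us" and k: "k < length ps"
    and L: "lcm_at l i \<preceq> L"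
    and e: "e \<noteq> 0" and rest: "smult (single (L - lcm_at l i) 1) (syz l i) - smult e (syz_pair (ps ! k))
      \<in> smult.span (syz_pair ` (set ps - {ps ! k}))"
  shows "lcm_pair (ps ! k) \<preceq> lcm_at l i"
proof -
  have "(syz l i :: nat \<Rightarrow>\<^sub>0 ('n, 'k) mpoly) \<in> syz_map ps ` free_module (length ps)"
    unfolding syz_map_image span by (rule syz_in_syzygies[OF li])
  then obtain x where x: "x \<in> free_module (length ps)" "syz_map ps x = (syz l i :: nat \<Rightarrow>\<^sub>0 ('n, 'k) mpoly)"
    by (metis imageE)
  define y where "y = multi.part (\<lambda>l. lcm_pair (ps ! l)) (lcm_at l i) x"
  have y_free: "y \<in> free_module (length ps)"
    unfolding y_def by (rule multi.part_in_free_module[OF x(1)])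
  have "syz_map ps y = multi.part ((!) us) (lcm_at l i) (syz_map ps x)"
    unfolding y_def by (rule multi.part_linear_map[OF linear_map_syz_map homog_syz_map x(1)])
  then have y: "syz_map ps y = syz l i" by (simp add: x(2) multi.part_homog[OF homog_syz])
  obtain z where z: "syz_map ps z = smult (single (L - lcm_at l i) 1) (syz l i) - smult e (syz_pair (ps ! k))"
      "lookup z k = 0" "z \<in> free_module (length ps)"
    using syz_map_avoiding[OF k rest] .
  let ?u = "smult (single (L - lcm_at l i) 1) y - smult e (basis_vec k) - z"
  have "?u \<in> free_module (length ps)"
    using y_free z(3) k
    by (intro smult.subspace_diff[OF subspace_free_module] smult.subspace_scale[OF subspace_free_module]) simp_all
  moreover have "syz_map ps ?u = 0"
    using k by (simp add: linear_map_diff[OF linear_map_syz_map] linear_map_scale[OF linear_map_syz_map] y z(1))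
  ultimately have "?u = 0" using inj by blast
  then have "lookup ?u k = 0" by simp
  then have "single (L - lcm_at l i) 1 * lookup y k = e"
    by (simp add: lookup_minus lookup_smult lookup_basis_vec z(2))
  then have "lookup y k \<noteq> 0" using e by auto
  then obtain v where "v \<in> keys (lookup y k)"
    by (auto simp: poly_mapping_eq_iff fun_eq_iff in_keys_iff)
  moreover have "multi.homog (\<lambda>l. lcm_pair (ps ! l)) (lcm_at l i) y"
    unfolding y_def by (rule multi.homog_part)
  ultimately have "v + lcm_pair (ps ! k) = lcm_at l i" unfolding multi.homog_def by blast
  then show ?thesis using expo_dvd_add by metis
qed

end

lemma expo_dvd_sum_list: "u \<in> set vs \<Longrightarrow> u \<preceq> sum_list vs"
  by (induction vs) (auto simp: expo_dvd_def lookup_add intro: trans_le_add1 trans_le_add2)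

context equigenerated
begin

text \<open>
  Start with one generator and repeatedly add the far end \<open>i\<close> of a relation \<open>b = {j, i}\<close> that crosses
  the boundary of the set \<open>W\<close> reached so far. Throughout, the syzygies between members of \<open>W\<close>,
  scaled to a common multidegree, are spanned by the relations inside \<open>W\<close>. Hence \<open>\<tau>\<^sub>l\<^sub>i\<close>, for \<open>l\<close> in \<open>W\<close>, is up to monomial factors the
  sum of a combination of inner relations and \<open>\<plusminus>\<tau>\<^sub>b\<close>, and \<open>lcm_dvd_of_crossing\<close> applies to \<open>b\<close>.
\<close>
lemma order_by_growing_tree:
  assumes ps: "set ps \<subseteq> index_pairs"
    and span: "smult.span (syz_pair ` set ps) = (syzygies :: (nat \<Rightarrow>\<^sub>0 ('n, 'k::comm_ring_1) mpoly) set)"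
    and inj: "\<forall>x\<in>free_module (length ps). syz_map ps x = (0 :: nat \<Rightarrow>\<^sub>0 ('n, 'k) mpoly) \<longrightarrow> x = 0"
    and linear: "\<forall>b\<in>set ps. expo_deg (lcm_pair b) = d + 1"
    and "us \<noteq> []"
  shows "\<exists>os. distinct os \<and> set os = {..<length us} \<and>
    (\<forall>k. 1 \<le> k \<and> k < length os \<longrightarrow> (\<exists>j\<in>set (take k os). expo_deg (lcm_at j (os ! k)) = d + 1 \<and>
        (\<forall>l\<in>set (take k os). lcm_at j (os ! k) \<preceq> lcm_at l (os ! k))))"
proof -
  \<comment> \<open>A common multiple of all generators. Brought to the multidegree \<open>L\<close>, the syzygies become the
    differences \<open>\<sigma>\<close>, which satisfy \<open>\<sigma> p q + \<sigma> q s = \<sigma> p s\<close> without any monomial factors.\<close>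
  define L where "L = sum_list us"
  define \<sigma> :: "nat \<Rightarrow> nat \<Rightarrow> (nat \<Rightarrow>\<^sub>0 ('n, 'k) mpoly)"
    where "\<sigma> p q = single p (single (L - us ! p) 1) - single q (single (L - us ! q) 1)" for p q
  define inner where "inner W = {b \<in> set ps. fst b \<in> W \<and> snd b \<in> W}" for W
  define joined where "joined W \<longleftrightarrow> (\<forall>p\<in>W. \<forall>q\<in>W. \<sigma> p q \<in> smult.span (syz_pair ` inner W))" for W
  define attachable where "attachable A i \<longleftrightarrow> (\<exists>j\<in>A. expo_deg (lcm_at j i) = d + 1 \<and>
    (\<forall>l\<in>A. lcm_at j i \<preceq> lcm_at l i))" for A i
  have dvd_L: "lcm_at p q \<preceq> L" if "p < length us" "q < length us" for p q
    unfolding lcm_at_def expo_lcm_dvd_iff L_def using that by (simp add: expo_dvd_sum_list)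
  have \<sigma>: "smult (single (L - lcm_at p q) 1) (syz p q) = \<sigma> p q" if "p < length us" "q < length us" for p q
    unfolding \<sigma>_def by (rule smult_monomial_syz[OF dvd_L[OF that]])
  have step: "\<exists>i<length us. i \<notin> W \<and> attachable W i \<and> joined (insert i W)"
    if W: "W \<subseteq> {..<length us}" "W \<noteq> {..<length us}" "W \<noteq> {}" and joined: "joined W" for W
  proof -
    obtain l0 i0 where "l0 \<in> W" "l0 < length us" "i0 \<notin> W" "i0 < length us"
      using W by blast
    then obtain b where b: "b \<in> set ps" "fst b \<in> W \<longleftrightarrow> snd b \<notin> W"
      using crossing_relation[OF span] by blast
    have blen: "fst b < length us" "snd b < length us" using b(1) ps by auto
    define j where "j = (if fst b \<in> W then fst b else snd b)"
    define i where "i = (if fst b \<in> W then snd b else fst b)"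
    define e :: "('n, 'k) mpoly"
      where "e = (if fst b \<in> W then single (L - lcm_pair b) 1 else - single (L - lcm_pair b) 1)"
    have ji: "j \<in> W" "i \<notin> W" "j < length us" "i < length us"
      using b(2) blen by (auto simp: j_def i_def)
    have lcm_ji: "lcm_at j i = lcm_pair b"
      by (simp add: j_def i_def lcm_at_def expo_lcm_commute)
    have e0: "e \<noteq> 0" by (simp add: e_def)
    have \<sigma>_ji: "\<sigma> j i = smult e (syz_pair b)"
      using \<sigma>[OF blen] by (auto simp: j_def i_def e_def \<sigma>_def)
    have divides: "lcm_at j i \<preceq> lcm_at l i" if l: "l \<in> W" for l
    proof -
      obtain k where k: "k < length ps" "b = ps ! k" using b(1) by (auto simp: in_set_conv_nth)
      have llen: "l < length us" using l W(1) by auto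
      have "\<sigma> l j \<in> smult.span (syz_pair ` inner W)" using joined l ji(1) by (simp add: joined_def)
      moreover have "inner W \<subseteq> set ps - {b}" using b(2) by (auto simp: inner_def)
      then have "smult.span (syz_pair ` inner W) \<subseteq>
          (smult.span (syz_pair ` (set ps - {b})) :: (nat \<Rightarrow>\<^sub>0 ('n, 'k) mpoly) set)"
        by (intro smult.span_mono image_mono)
      moreover have "\<sigma> l i - smult e (syz_pair b) = \<sigma> l j"
        unfolding \<sigma>_ji[symmetric] by (simp add: \<sigma>_def)
      ultimately have "\<sigma> l i - smult e (syz_pair (ps ! k)) \<in> smult.span (syz_pair ` (set ps - {ps ! k}))"
        using k(2) by auto
      then have "lcm_pair (ps ! k) \<preceq> lcm_at l i"
        unfolding \<sigma>[OF llen ji(4), symmetric]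
        by (rule lcm_dvd_of_crossing[OF span inj llen ji(4) k(1) dvd_L[OF llen ji(4)] e0])
      then show ?thesis by (simp add: lcm_ji k(2))
    qed
    have "attachable W i"
      unfolding attachable_def by (rule bexI[OF _ ji(1)]) (use divides linear[rule_format, OF b(1)] lcm_ji in simp)
    moreover have "joined (insert i W)"
    proof -
      let ?S = "smult.span (syz_pair ` inner (insert i W)) :: (nat \<Rightarrow>\<^sub>0 ('n, 'k) mpoly) set"
      have "smult.span (syz_pair ` inner W) \<subseteq> ?S"
        by (intro smult.span_mono image_mono) (auto simp: inner_def)
      then have old: "\<sigma> p q \<in> ?S" if "p \<in> W" "q \<in> W" for p q
        using joined that by (auto simp: joined_def)
      have "b \<in> inner (insert i W)" using b ji by (auto simp: inner_def i_def)
      then have \<sigma>_in: "\<sigma> j i \<in> ?S"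
        unfolding \<sigma>_ji by (intro smult.span_scale smult.span_base imageI)
      have new: "\<sigma> p i \<in> ?S" if "p \<in> W" for p
      proof -
        have "\<sigma> p j + \<sigma> j i \<in> ?S" by (rule smult.span_add[OF old[OF that ji(1)] \<sigma>_in])
        then show ?thesis by (simp add: \<sigma>_def)
      qed
      have "\<sigma> i p \<in> ?S" if "p \<in> W" for p
        using smult.span_neg[OF new[OF that]] by (simp add: \<sigma>_def)
      moreover have "\<sigma> i i \<in> ?S" by (simp add: \<sigma>_def smult.span_zero)
      ultimately show ?thesis unfolding joined_def using old new by blast
    qed
    ultimately show ?thesis using ji by blast
  qed
  have "\<exists>os. length os = Suc n \<and> distinct os \<and> set os \<subseteq> {..<length us} \<and> joined (set os) \<and>
      (\<forall>k. 1 \<le> k \<and> k < length os \<longrightarrow> attachable (set (take k os)) (os ! k))" if "n < length us" for n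
    using that
  proof (induction n)
    case 0
    have "joined {0}" by (simp add: joined_def \<sigma>_def smult.span_zero)
    then show ?case using 0 by (intro exI[of _ "[0]"]) auto
  next
    case (Suc n)
    then have "n < length us" by simp
    from Suc.IH[OF this] obtain os where os: "length os = Suc n" "distinct os"
      "set os \<subseteq> {..<length us}" "joined (set os)"
      and good: "\<forall>k. 1 \<le> k \<and> k < length os \<longrightarrow> attachable (set (take k os)) (os ! k)"
      by (elim exE conjE) (rule that)
    have card: "card (set os) = Suc n" using os(1,2) by (simp add: distinct_card)
    have "set os \<noteq> {..<length us}"
    proof
      assume "set os = {..<length us}"
      then show False using card Suc.prems by simp
    qed
    moreover have "set os \<noteq> {}" using os(1) by auto
    ultimately have "\<exists>i<length us. i \<notin> set os \<and> attachable (set os) i \<and> joined (insert i (set os))"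
      by (intro step os)
    then obtain i where i: "i < length us" "i \<notin> set os" "attachable (set os) i" "joined (insert i (set os))"
      by blast
    have "attachable (set (take k (os @ [i]))) ((os @ [i]) ! k)" if k: "1 \<le> k" "k < length (os @ [i])" for k
    proof (cases "k = length os")
      case True
      then show ?thesis using i(3) by simp
    next
      case False
      then have "k < length os" using k(2) by simp
      then show ?thesis using good k(1) by (simp add: nth_append)
    qed
    then have "\<forall>k. 1 \<le> k \<and> k < length (os @ [i]) \<longrightarrow> attachable (set (take k (os @ [i]))) ((os @ [i]) ! k)"
      by blast
    moreover have "length (os @ [i]) = Suc (Suc n)" "distinct (os @ [i])"
      "set (os @ [i]) \<subseteq> {..<length us}" "joined (set (os @ [i]))"
      using os i by simp_all
    ultimately show ?case by blast
  qed
  moreover have "length us - 1 < length us" "Suc (length us - 1) = length us" using \<open>us \<noteq> []\<close> by simp_all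
  ultimately obtain os where os: "length os = length us" "distinct os" "set os \<subseteq> {..<length us}"
    and good: "\<forall>k. 1 \<le> k \<and> k < length os \<longrightarrow> attachable (set (take k os)) (os ! k)"
    by metis
  have "set os = {..<length us}"
    using os by (intro card_subset_eq) (simp_all add: distinct_card)
  then show ?thesis using os(2) good unfolding attachable_def by blast
qed

lemma syzygies_spanned_pairs:
  "(syzygies :: (nat \<Rightarrow>\<^sub>0 ('n, 'k::comm_ring_1) mpoly) set) \<subseteq> smult.span (syz_pair ` index_pairs)"
proof -
  have "{syz p q | p q. p < length us \<and> q < length us} \<subseteq>
      (syz_pair ` index_pairs :: (nat \<Rightarrow>\<^sub>0 ('n, 'k) mpoly) set)"
  proof clarify
    fix p q assume "p < length us" "q < length us"
    then show "(syz p q :: nat \<Rightarrow>\<^sub>0 ('n, 'k) mpoly) \<in> syz_pair ` index_pairs"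
      by (intro image_eqI[of _ _ "(p, q)"]) simp_all
  qed
  then show ?thesis using subset_trans[OF syzygies_spanned smult.span_mono] by blast
qed

text \<open>
  In the order given by \<open>order_by_growing_tree\<close> the quotient \<open>lcm(u\<^sub>j, u\<^sub>i) / u\<^sub>i\<close> has degree one, so it
  is a variable, and this variable generates the colon ideal at \<open>i\<close>.
\<close>
lemma linear_quotients_of_relations:
  assumes ps: "set ps \<subseteq> index_pairs"
    and span: "smult.span (syz_pair ` set ps) = (syzygies :: (nat \<Rightarrow>\<^sub>0 ('n, 'k::comm_ring_1) mpoly) set)"
    and inj: "\<forall>x\<in>free_module (length ps). syz_map ps x = (0 :: nat \<Rightarrow>\<^sub>0 ('n, 'k) mpoly) \<longrightarrow> x = 0"
    and linear: "\<forall>b\<in>set ps. expo_deg (lcm_pair b) = d + 1"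
    and "us \<noteq> []"
  shows "\<exists>vs. distinct vs \<and> set vs = set us \<and>
    (\<forall>i. 1 \<le> i \<and> i < length vs \<longrightarrow>
      (\<exists>X. colon (ideal_of (monomial ` set (take i vs))) (monomial (vs ! i)) =
        (ideal_of (var ` X) :: ('n, 'k) mpoly set)))"
proof -
  obtain os where os: "distinct os" "set os = {..<length us}"
    "\<forall>k. 1 \<le> k \<and> k < length os \<longrightarrow> (\<exists>j\<in>set (take k os). expo_deg (lcm_at j (os ! k)) = d + 1 \<and>
        (\<forall>l\<in>set (take k os). lcm_at j (os ! k) \<preceq> lcm_at l (os ! k)))"
    using order_by_growing_tree[OF assms] by (elim exE conjE) (rule that)
  define vs where "vs = map ((!) us) os"
  have "distinct vs"
    using os(1,2) distinct_us by (auto simp: vs_def distinct_map inj_on_def nth_eq_iff_index_eq)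
  moreover have "set vs = set us"
  proof -
    have "set vs = (!) us ` {..<length us}" by (simp add: vs_def os(2))
    also have "\<dots> = set us" by (auto simp: set_conv_nth)
    finally show ?thesis .
  qed
  moreover have "\<exists>X. colon (ideal_of (monomial ` set (take i vs))) (monomial (vs ! i)) =
      (ideal_of (var ` X) :: ('n, 'k) mpoly set)" if i: "1 \<le> i" "i < length vs" for i
  proof -
    have ilen: "i < length os" using i by (simp add: vs_def)
    let ?u = "us ! (os ! i)"
    have u: "vs ! i = ?u" using ilen by (simp add: vs_def)
    have oslen: "os ! i < length us" using os(2) nth_mem[OF ilen] by simp
    obtain j where j: "j \<in> set (take i os)" "expo_deg (lcm_at j (os ! i)) = d + 1"
      "\<forall>l\<in>set (take i os). lcm_at j (os ! i) \<preceq> lcm_at l (os ! i)"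
      using os(3)[rule_format, OF conjI[OF i(1) ilen]] by (elim bexE conjE) (rule that)
    have lcm_eq: "(us ! j - ?u) + ?u = lcm_at j (os ! i)"
      using expo_lcm_commute[of "us ! j" ?u] by (simp add: lcm_at_def expo_lcm_def)
    then have "expo_deg (us ! j - ?u) + d = d + 1"
      using expo_deg_add[of "us ! j - ?u" ?u] oslen j(2) by simp
    then have "expo_deg (us ! j - ?u) = 1" by simp
    then obtain x where x: "us ! j - ?u = single x 1" by (rule expo_deg_eq_1D)
    have A: "set (take i vs) = (!) us ` set (take i os)" by (simp add: vs_def take_map)
    have "us ! j \<preceq> single x 1 + ?u" using index_dvd_lcm_at(1)[of j "os ! i"] lcm_eq x by simp
    moreover have "lookup ?u x < lookup (us ! l) x" if l: "l \<in> set (take i os)" for l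
    proof -
      have "single x 1 + ?u \<preceq> lcm_at l (os ! i)" using j(3)[rule_format, OF l] lcm_eq x by simp
      then have "1 + lookup ?u x \<le> max (lookup (us ! l) x) (lookup ?u x)"
        unfolding expo_dvd_def lcm_at_def lookup_expo_lcm lookup_add
        by (auto dest: spec[of _ x])
      then show ?thesis by simp
    qed
    ultimately have "colon (ideal_of (monomial ` (!) us ` set (take i os))) (monomial ?u) =
        (ideal_of (var ` {x}) :: ('n, 'k) mpoly set)"
      using j(1) by (intro colon_eq_variable) auto
    then have "colon (ideal_of (monomial ` set (take i vs))) (monomial (vs ! i)) =
        (ideal_of (var ` {x}) :: ('n, 'k) mpoly set)"
      by (simp only: u A)
    then show ?thesis by blast
  qed
  ultimately show ?thesis by blast
qed

end

section \<open>The equivalence\<close>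

lemma projective_zero: "projective {0 :: nat \<Rightarrow>\<^sub>0 'a::comm_ring_1}"
  unfolding projective_def by (intro exI[of _ "\<lambda>_. 0"]) (auto intro: linear_mapI)

lemma zero_ideal_resolution: "has_projective_resolution_of_length {0 :: 'a::comm_ring_1} 0"
proof -
  have "module_hom smult (*) (\<lambda>_ :: nat \<Rightarrow>\<^sub>0 'a. 0 :: 'a)"
    by (simp add: module_hom_iff module_smult module_mult)
  moreover have "linear_map (\<lambda>_ :: nat \<Rightarrow>\<^sub>0 'a. 0)" by (rule linear_mapI) simp_all
  ultimately have "is_resolution {0} (\<lambda>_. {0}) (\<lambda>_ :: nat \<Rightarrow>\<^sub>0 'a. 0) (\<lambda>_ _. 0)"
    unfolding is_resolution_def by auto
  then show ?thesis
    unfolding has_projective_resolution_of_length_def using projective_zero by blast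
qed

text \<open>
  An infimum of natural numbers is attained, which gives the resolution; the zero ideal has the zero
  resolution of length 0.
\<close>
lemma projective_dimension_1D:
  fixes I :: "'a::comm_ring_1 set"
  assumes "projective_dimension I = 1"
  shows "has_projective_resolution_of_length I 1" and "I \<noteq> {0}"
proof -
  let ?A = "{p. has_projective_resolution_of_length I p}"
  have ne: "?A \<noteq> {}"
  proof
    assume "?A = {}"
    then have "projective_dimension I = Inf {}" by (simp only: projective_dimension_def image_empty)
    then show False using assms by (simp add: top_enat_def)
  qed
  then obtain p where "enat p \<in> enat ` ?A" by blast
  then have "Inf (enat ` ?A) \<in> enat ` ?A" by (rule wellorder_InfI)
  then show "has_projective_resolution_of_length I 1"
    using assms by (auto simp: projective_dimension_def one_enat_def)
  show "I \<noteq> {0}"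
  proof
    assume "I = {0}"
    then have "enat 0 \<in> enat ` ?A" using zero_ideal_resolution by blast
    then have "Inf (enat ` ?A) \<le> enat 0" by (rule Inf_lower)
    then show False using assms by (simp add: projective_dimension_def one_enat_def)
  qed
qed

lemma finite_expo_deg: "finite {u :: ('n::finite) expo. expo_deg u = d}"
proof -
  have "finite {f :: 'n \<Rightarrow> nat. \<forall>i. f i \<in> {..d}}"
    using finite_set_of_finite_funs[of "UNIV :: 'n set" "{..d}" 0] by simp
  moreover have "lookup ` {u :: 'n expo. expo_deg u = d} \<subseteq> {f. \<forall>i. f i \<in> {..d}}"
    unfolding expo_deg_def by (auto intro!: member_le_sum)
  ultimately have "finite (lookup ` {u :: 'n expo. expo_deg u = d})" by (rule finite_subset[rotated])
  then show ?thesis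
  proof (rule finite_imageD)
    show "inj_on lookup {u :: 'n expo. expo_deg u = d}"
      by (rule inj_onI) (simp only: lookup_inject)
  qed
qed

theorem proposition3p1:
  fixes I :: "('n::finite, 'k::field) mpoly set" and d :: nat
  assumes "monomial_ideal I"
    and "projective_dimension I = 1"
    and "generated_in_degree d I"
  shows "(has_linear_relations I \<longleftrightarrow> has_linear_resolution I) \<and>
    (has_linear_resolution I \<longleftrightarrow> has_linear_quotients I)"
proof -
  note pd = projective_dimension_1D[OF assms(2)]
  have gens: "ideal_of (monomial ` min_gens I) = I"
    using min_gens_generates[OF assms(1)] unfolding minimal_monomial_generating_set_def by blast
  have deg: "\<And>u. u \<in> min_gens I \<Longrightarrow> expo_deg u = d"
    using assms(3) unfolding generated_in_degree_def by blast
  have ne: "min_gens I \<noteq> {}"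
  proof
    assume "min_gens I = {}"
    then have "I = {0}" using gens module.span_empty[OF module_mult] by (metis image_empty)
    then show False using pd(2) by blast
  qed
  have "finite (min_gens I)"
    using deg by (intro finite_subset[OF _ finite_expo_deg[of d]]) blast
  then obtain us where us: "set us = min_gens I" "distinct us" using finite_distinct_list by blast
  interpret U: equigenerated us d
    by unfold_locales (use us deg in auto)
  have I_us: "I = ideal_of (monomial ` set us)" using gens us(1) by simp
  obtain ps where ps: "distinct ps" "set ps \<subseteq> U.index_pairs"
    "smult.span (U.syz_pair ` set ps) = (U.syzygies :: (nat \<Rightarrow>\<^sub>0 ('n, 'k) mpoly) set)"
    "\<forall>b\<in>set ps.
      (U.syz_pair b :: nat \<Rightarrow>\<^sub>0 ('n, 'k) mpoly) \<notin> smult.span (U.syz_pair ` (set ps - {b}))"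
    using U.irredundant_relations[OF subset_refl U.syzygies_spanned_pairs] by (elim exE conjE) (rule that)
  obtain a \<epsilon> \<delta> where a: "minimal_graded_free_resolution I a \<epsilon> \<delta>"
    "a 0 = replicate (length us) d" "a 1 = map (\<lambda>b. expo_deg (U.lcm_pair b)) ps"
    using U.taylor_resolution[OF I_us pd(1) ps] by (elim exE conjE) (rule that)
  define b where "b = (SOME a. \<exists>\<epsilon> \<delta>. minimal_graded_free_resolution I a \<epsilon> \<delta>)"
  have "\<exists>a \<epsilon> \<delta>. minimal_graded_free_resolution I a \<epsilon> \<delta>" using a(1) by blast
  from someI_ex[OF this] obtain \<epsilon>' \<delta>' where b: "minimal_graded_free_resolution I b \<epsilon>' \<delta>'"
    unfolding b_def by blast
  have betti: "graded_betti I i j = 0 \<longleftrightarrow> j \<notin> set (b i)" for i j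
    unfolding graded_betti_def b_def[symmetric] by (rule count_list_0_iff)
  have us_ne: "us \<noteq> []" using us(1) ne by auto
  have b0: "set (b 0) = {d}"
    using minimal_resolution_degrees_subset(1)[OF a(1) b] minimal_resolution_degrees_subset(1)[OF b a(1)]
      a(2) us_ne by auto
  have b1: "set (b 1) = set (a 1)"
    using minimal_resolution_degrees_subset(2)[OF a(1) b] minimal_resolution_degrees_subset(2)[OF b a(1)]
    by blast
  have b2: "b (Suc (Suc i)) = []" for i by (rule minimal_resolution_length[OF pd(1) b])
  have gt: "d < j" if j: "j \<in> set (b 1)" for j
  proof -
    obtain c where c: "c \<in> set ps" "j = expo_deg (U.lcm_pair c)"
      using j unfolding b1 a(3) by auto
    have "fst c \<noteq> snd c"
    proof
      assume "fst c = snd c"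
      then have "(U.syz_pair c :: nat \<Rightarrow>\<^sub>0 ('n, 'k) mpoly) \<in> smult.span (U.syz_pair ` (set ps - {c}))"
        by (simp add: smult.span_zero)
      with ps(4) c(1) show False by blast
    qed
    moreover have "fst c < length us" "snd c < length us" using c(1) ps(2) by auto
    ultimately show ?thesis unfolding c(2) by (intro U.deg_lcm_at)
  qed
  have "expo_deg ` min_gens I = {d}" using deg ne by auto
  then have max: "max_gen_deg I = d" by (simp add: max_gen_deg_def)
  \<comment> \<open>Here \<open>b\<close> lists the shifts of the resolution that defines the Betti numbers; by comparison with the
    Taylor resolution its degrees are \<open>d\<close> at 0 and the degrees of the lcms at 1.\<close>
  have relations: "has_linear_relations I \<longleftrightarrow> set (b 1) \<subseteq> {d + 1}"
  proof -
    have "has_linear_relations I \<longleftrightarrow> (\<forall>j\<in>set (b 1). j \<le> d + 1)"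
      unfolding has_linear_relations_def betti max using not_le by blast
    also have "\<dots> \<longleftrightarrow> set (b 1) \<subseteq> {d + 1}" using gt by (force simp: le_Suc_eq)
    finally show ?thesis .
  qed
  have resolution: "has_linear_resolution I \<longleftrightarrow> set (b 1) \<subseteq> {d + 1}"
  proof
    assume "has_linear_resolution I"
    then obtain e where e: "\<And>i j. j \<in> set (b i) \<Longrightarrow> j = i + e"
      unfolding has_linear_resolution_def has_d_linear_resolution_def betti by blast
    then have "e = d" using b0 e[of d 0] by simp
    then show "set (b 1) \<subseteq> {d + 1}" using e[of _ 1] by auto
  next
    assume lin: "set (b 1) \<subseteq> {d + 1}"
    have "j = i + d" if "j \<in> set (b i)" for i j
    proof -
      consider "i = 0" | "i = 1" | k where "i = Suc (Suc k)" by (metis One_nat_def not0_implies_Suc)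
      then show ?thesis
      proof cases
        case 1
        then show ?thesis using that b0 by simp
      next
        case 2
        then show ?thesis using that lin by auto
      next
        case 3
        then show ?thesis using that b2 by simp
      qed
    qed
    then show "has_linear_resolution I"
      unfolding has_linear_resolution_def has_d_linear_resolution_def betti by blast
  qed
  have quotients: "has_linear_quotients I \<longleftrightarrow> set (b 1) \<subseteq> {d + 1}"
  proof
    assume "has_linear_quotients I"
    then obtain vs where vs: "distinct vs" "set vs = min_gens I"
      and quot: "\<forall>i. 1 \<le> i \<and> i < length vs \<longrightarrow>
        (\<exists>X. colon (ideal_of (monomial ` set (take i vs))) (monomial (vs ! i)) =
          (ideal_of (var ` X) :: ('n, 'k) mpoly set))"
      unfolding has_linear_quotients_def by (elim exE conjE) (rule that)
    interpret V: equigenerated vs d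
      by unfold_locales (use vs deg in auto)
    have I_vs: "I = ideal_of (monomial ` set vs)" using gens vs(2) by simp
    have lin: "V.linear_pairs \<subseteq> V.index_pairs" unfolding V.linear_pairs_def by blast
    have gen: "(V.syzygies :: (nat \<Rightarrow>\<^sub>0 ('n, 'k) mpoly) set) \<subseteq> smult.span (V.syz_pair ` V.linear_pairs)"
      by (rule V.linear_relations_of_quotients[OF quot])
    obtain qs where qs: "distinct qs" "set qs \<subseteq> V.linear_pairs"
      "smult.span (V.syz_pair ` set qs) = (V.syzygies :: (nat \<Rightarrow>\<^sub>0 ('n, 'k) mpoly) set)"
      "\<forall>b\<in>set qs.
        (V.syz_pair b :: nat \<Rightarrow>\<^sub>0 ('n, 'k) mpoly) \<notin> smult.span (V.syz_pair ` (set qs - {b}))"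
      using V.irredundant_relations[OF lin gen] by (elim exE conjE) (rule that)
    have qs_index: "set qs \<subseteq> V.index_pairs" using qs(2) unfolding V.linear_pairs_def by blast
    obtain c \<epsilon>'' \<delta>'' where c: "minimal_graded_free_resolution I c \<epsilon>'' \<delta>''"
      "c 1 = map (\<lambda>b. expo_deg (V.lcm_pair b)) qs"
      using V.taylor_resolution[OF I_vs pd(1) qs(1) qs_index qs(3,4)] by (elim exE conjE) (rule that)
    have "set (b 1) \<subseteq> set (c 1)" by (rule minimal_resolution_degrees_subset(2)[OF c(1) b])
    also have "\<dots> \<subseteq> {d + 1}" using qs(2) unfolding c(2) V.linear_pairs_def by auto
    finally show "set (b 1) \<subseteq> {d + 1}" .
  next
    assume "set (b 1) \<subseteq> {d + 1}"
    then have lin: "\<forall>c\<in>set ps. expo_deg (U.lcm_pair c) = d + 1"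
      unfolding b1 a(3) by auto
    note inj = U.irredundant_relations_free[OF I_us pd(1) ps(1,3,4)]
    show "has_linear_quotients I"
      unfolding has_linear_quotients_def us(1)[symmetric]
      by (rule U.linear_quotients_of_relations[OF ps(2,3) inj lin us_ne])
  qed
  show ?thesis by (simp only: relations resolution quotients)
qed

end
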